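(* Let $q>0$, $q\neq 1$, $M\in\mathbb N$, $\vec k=(k_1,\dots,k_M)$ with all $k_j>0$, and $\rho\in\mathbb R$. For $\eta\in X_d$ and $\xi\in\mathcal S_\rho$ define $$P_{\mathsf R}(\eta,\xi)=q^{-\frac12 u(\eta,\vec k)}\prod_{j=1}^M p_{\mathrm A}\big(\eta_j,\xi_j;h^+_{j+1}(\xi);k_j;q\big).$$ Then $P_{\mathsf R}$ is a duality function between $\mathrm{ASIP}(q,\vec k)$ and $\mathrm{ASIP}_{\mathsf R}(q,\vec k,\rho)$, i.e. for all $\eta\in X_d$ and $\xi\in\mathcal S_\rho$, $$\big[L^{\mathrm{ASIP}}_{q,\vec k}P_{\mathsf R}(\cdot,\xi)\big](\eta)=\big[L^{\mathrm{ASIP}_{\mathsf R}}_{q,\vec k,\rho}P_{\mathsf R}(\eta,\cdot)\big](\xi).$$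
   Context: Notation: $X_d=\mathbb Z_{\ge 0}^M$; $|\eta|=\eta_1+\dots+\eta_M$; $[a]_q=\frac{q^a-q^{-a}}{q-q^{-1}}$; $(a;q)_n=\prod_{i=0}^{n-1}(1-aq^i)$. The $q$-hypergeometric series is ${}_{3}\varphi_2(a_1,a_2,a_3;b_1,b_2;q,z)=\sum_{n\ge0}\frac{(a_1;q)_n(a_2;q)_n(a_3;q)_n}{(b_1;q)_n(b_2;q)_n}\frac{z^n}{(q;q)_n}$, and if some upper parameter is $q^{-N}$ ($N\in\mathbb Z_{\ge0}$), it is a finite sum over $n\le N$. $\eta^{j,m}$ is the state obtained from $\eta$ by moving one particle from site $j$ to site $m$ if $\eta_j\ge1$, and $\eta^{j,m}=\eta$ otherwise. $\mathrm{ASIP}(q,\vec k)$ on $X_d$ has generator $$[L^{\mathrm{ASIP}}_{q,\vec k}f](\eta)=\sum_{j=1}^{M-1}c_j^+(\eta)[f(\eta^{j,j+1})-f(\eta)]+c_{j+1}^-(\eta)[f(\eta^{j+1,j})-f(\eta)],$$ $c_j^+=q^{\eta_j+k_j-\eta_{j+1}-1}[\eta_j]_q[\eta_{j+1}+k_{j+1}]_q$, $\;c_j^-=q^{-(\eta_j+k_j-\eta_{j-1}-1)}[\eta_j]_q[\eta_{j-1}+k_{j-1}]_q$. Height function: $h^+_{M+1}=\rho$, $h^+_j(\xi)=\rho+\sum_{i=j}^M(2\xi_i+k_i)$. State space: $\mathcal S_\rho=X_d$ if $\rho>-1$, and $\mathcal S_\rho=\{\xi\in X_d:2|\xi|+|\vec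 k|+\rho<0\}$ if $\rho\le-1$. $\mathrm{ASIP}_{\mathsf R}(q,\vec k,\rho)$ (right dynamic ASIP) on $\mathcal S_\rho$ has generator $$[L^{\mathrm{ASIP}_{\mathsf R}}_{q,\vec k,\rho}f](\xi)=\sum_{j=1}^{M-1}C_j^{\mathsf R,+}(\xi)[f(\xi^{j,j+1})-f(\xi)]+C_{j+1}^{\mathsf R,-}(\xi)[f(\xi^{j+1,j})-f(\xi)],$$ $$C_j^{\mathsf R,+}=[\xi_j]_q[\xi_{j+1}+k_{j+1}]_q\frac{[h^+_j-\xi_j]_q[h^+_{j+1}-\xi_{j+1}]_q}{[h^+_{j+1}]_q[h^+_{j+1}+1]_q},\qquad C_j^{\mathsf R,-}=[\xi_j]_q[\xi_{j-1}+k_{j-1}]_q\frac{[h^+_j+\xi_{j-1}]_q[h^+_{j+1}+\xi_j]_q}{[h^+_j]_q[h^+_j-1]_q},$$ with $h^+_i=h^+_i(\xi)$. Conventions: a rate is $0$ when the departing site is empty ($\xi_j=0$), and $[h^+_{j+1}-\xi_{j+1}]_q/[h^+_{j+1}]_q$ is read as $1$ when $\xi_{j+1}=0$. $u(\eta,\vec k)=\sum_{j=1}^M\eta_j\big(k_j+2\sum_{i=1}^{j-1}k_i\big)$. Al-Salam–Chihara polynomials (renormalized): for $n,x\in\mathbb Z_{\ge0}$, $$p_{\mathrm A}(n,x;\rho;k;q)=q^{-\frac12n(2\rho+k+1)}\,{}_3\varphi_2\big(q^{-2n},q^{-2x},q^{2x+2\rho+2k};\,q^{2k},0;\,q^2,q^2\big).$$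 *)

theory Defs
  imports Complex_Main "HOL-Library.FuncSet"
begin

definition q_num :: "real \<Rightarrow> real \<Rightarrow> real" where
  "q_num q a = (q powr a - q powr (- a)) / (q - inverse q)"

definition q_poch :: "real \<Rightarrow> real \<Rightarrow> nat \<Rightarrow> real" where
  "q_poch a q n = (\<Prod>i<n. 1 - a * q ^ i)"

definition phi32 :: "real \<Rightarrow> real \<Rightarrow> real \<Rightarrow> real \<Rightarrow> real \<Rightarrow> real \<Rightarrow> real \<Rightarrow> real" where
  "phi32 a1 a2 a3 b1 b2 q z =
     (\<Sum>n. (q_poch a1 q n * q_poch a2 q n * q_poch a3 q n) / (q_poch b1 q n * q_poch b2 q n)
            * (z ^ n / q_poch q q n))"

text \<open>
  Below, the first upper parameter is \<open>(q\<^sup>2) ^ (- n)\<close> in base \<open>q\<^sup>2\<close>, so the series above has only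
  finitely many nonzero terms and converges also for \<open>q > 1\<close>.
\<close>

definition p_A :: "real \<Rightarrow> nat \<Rightarrow> nat \<Rightarrow> real \<Rightarrow> real \<Rightarrow> real" where
  "p_A q n x \<rho> k =
     q powr (- (1 / 2) * real n * (2 * \<rho> + k + 1)) *
     phi32 (q powr (- 2 * real n)) (q powr (- 2 * real x)) (q powr (2 * real x + 2 * \<rho> + 2 * k))
           (q powr (2 * k)) 0 (q\<^sup>2) (q\<^sup>2)"

text \<open>
  Sites are \<open>1, \<dots>, M\<close>. Configurations are extensional functions on \<open>{1..M}\<close>, so that each vector
  of \<open>M\<close> natural numbers is represented exactly once. The parameters \<open>k j\<close> matter only for
  \<open>j \<in> {1..M}\<close>.
\<close>

type_synonym config = "nat \<Rightarrow> nat"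

definition configs :: "nat \<Rightarrow> config set" where
  "configs M = {1..M} \<rightarrow>\<^sub>E UNIV"

definition move :: "config \<Rightarrow> nat \<Rightarrow> nat \<Rightarrow> config" where
  "move \<eta> j m =
     (if \<eta> j \<ge> 1
      then let \<eta>' = \<eta>(j := \<eta> j - 1) in \<eta>'(m := \<eta>' m + 1)
      else \<eta>)"

text \<open>
  Generator of a nearest-neighbour jump process on \<open>{1..M}\<close>; \<open>cp j \<eta>\<close> and \<open>cm j \<eta>\<close> are the rates
  of a jump from \<open>j\<close> to \<open>j + 1\<close> and to \<open>j - 1\<close>, respectively.
\<close>

definition jump_generator ::
    "nat \<Rightarrow> (nat \<Rightarrow> config \<Rightarrow> real) \<Rightarrow> (nat \<Rightarrow> config \<Rightarrow> real) \<Rightarrow> (config \<Rightarrow> real) \<Rightarrow> config \<Rightarrow> real" where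
  "jump_generator M cp cm f \<eta> =
     (\<Sum>j\<in>{1..<M}. cp j \<eta> * (f (move \<eta> j (j + 1)) - f \<eta>)
                 + cm (j + 1) \<eta> * (f (move \<eta> (j + 1) j) - f \<eta>))"

definition asip_rate_right :: "real \<Rightarrow> (nat \<Rightarrow> real) \<Rightarrow> nat \<Rightarrow> config \<Rightarrow> real" where
  "asip_rate_right q k j \<eta> =
     q powr (real (\<eta> j) + k j - real (\<eta> (j + 1)) - 1) *
     q_num q (real (\<eta> j)) * q_num q (real (\<eta> (j + 1)) + k (j + 1))"

definition asip_rate_left :: "real \<Rightarrow> (nat \<Rightarrow> real) \<Rightarrow> nat \<Rightarrow> config \<Rightarrow> real" where
  "asip_rate_left q k j \<eta> =
     q powr (- (real (\<eta> j) + k j - real (\<eta> (j - 1)) - 1)) *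
     q_num q (real (\<eta> j)) * q_num q (real (\<eta> (j - 1)) + k (j - 1))"

definition asip_generator ::
    "real \<Rightarrow> nat \<Rightarrow> (nat \<Rightarrow> real) \<Rightarrow> (config \<Rightarrow> real) \<Rightarrow> config \<Rightarrow> real" where
  "asip_generator q M k = jump_generator M (asip_rate_right q k) (asip_rate_left q k)"

definition height :: "nat \<Rightarrow> (nat \<Rightarrow> real) \<Rightarrow> real \<Rightarrow> nat \<Rightarrow> config \<Rightarrow> real" where
  "height M k \<rho> j \<xi> = \<rho> + (\<Sum>i=j..M. 2 * real (\<xi> i) + k i)"

definition dyn_configs :: "nat \<Rightarrow> (nat \<Rightarrow> real) \<Rightarrow> real \<Rightarrow> config set" where
  "dyn_configs M k \<rho> =
     (if \<rho> > - 1 then configs M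
      else {\<xi> \<in> configs M. 2 * real (\<Sum>i=1..M. \<xi> i) + (\<Sum>i=1..M. k i) + \<rho> < 0})"

text \<open>
  Two conventions are spelled out because the height function may vanish: a jump from an empty site
  has rate 0, and the quotient \<open>[h - \<xi>] / [h]\<close> is read as 1 when \<open>\<xi> = 0\<close>.
\<close>

definition dyn_rate_right :: "real \<Rightarrow> nat \<Rightarrow> (nat \<Rightarrow> real) \<Rightarrow> real \<Rightarrow> nat \<Rightarrow> config \<Rightarrow> real" where
  "dyn_rate_right q M k \<rho> j \<xi> =
     (let h = (\<lambda>i. height M k \<rho> i \<xi>) in
      if \<xi> j = 0 then 0
      else q_num q (real (\<xi> j)) * q_num q (real (\<xi> (j + 1)) + k (j + 1)) *
           (q_num q (h j - real (\<xi> j)) / q_num q (h (j + 1) + 1)) *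
           (if \<xi> (j + 1) = 0 then 1
            else q_num q (h (j + 1) - real (\<xi> (j + 1))) / q_num q (h (j + 1))))"

definition dyn_rate_left :: "real \<Rightarrow> nat \<Rightarrow> (nat \<Rightarrow> real) \<Rightarrow> real \<Rightarrow> nat \<Rightarrow> config \<Rightarrow> real" where
  "dyn_rate_left q M k \<rho> j \<xi> =
     (let h = (\<lambda>i. height M k \<rho> i \<xi>) in
      if \<xi> j = 0 then 0
      else q_num q (real (\<xi> j)) * q_num q (real (\<xi> (j - 1)) + k (j - 1)) *
           ((q_num q (h j + real (\<xi> (j - 1))) * q_num q (h (j + 1) + real (\<xi> j)))
            / (q_num q (h j) * q_num q (h j - 1))))"

definition dyn_asip_generator ::
    "real \<Rightarrow> nat \<Rightarrow> (nat \<Rightarrow> real) \<Rightarrow> real \<Rightarrow> (config \<Rightarrow> real) \<Rightarrow> config \<Rightarrow> real" where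
  "dyn_asip_generator q M k \<rho> =
     jump_generator M (dyn_rate_right q M k \<rho>) (dyn_rate_left q M k \<rho>)"

definition duality_function ::
    "'a set \<Rightarrow> (('a \<Rightarrow> real) \<Rightarrow> 'a \<Rightarrow> real) \<Rightarrow> 'b set \<Rightarrow> (('b \<Rightarrow> real) \<Rightarrow> 'b \<Rightarrow> real) \<Rightarrow>
     ('a \<Rightarrow> 'b \<Rightarrow> real) \<Rightarrow> bool" where
  "duality_function X L1 Y L2 D \<longleftrightarrow>
     (\<forall>\<eta>\<in>X. \<forall>\<xi>\<in>Y. L1 (\<lambda>\<eta>'. D \<eta>' \<xi>) \<eta> = L2 (\<lambda>\<xi>'. D \<eta> \<xi>') \<xi>)"

definition u_weight :: "nat \<Rightarrow> (nat \<Rightarrow> real) \<Rightarrow> config \<Rightarrow> real" where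
  "u_weight M k \<eta> = (\<Sum>j=1..M. real (\<eta> j) * (k j + 2 * (\<Sum>i\<in>{1..<j}. k i)))"

definition P_R :: "real \<Rightarrow> nat \<Rightarrow> (nat \<Rightarrow> real) \<Rightarrow> real \<Rightarrow> config \<Rightarrow> config \<Rightarrow> real" where
  "P_R q M k \<rho> \<eta> \<xi> =
     q powr (- (1 / 2) * u_weight M k \<eta>) *
     (\<Prod>j=1..M. p_A q (\<eta> j) (\<xi> j) (height M k \<rho> (j + 1) \<xi>) (k j))"

end

theory Submission
  imports Defs
begin

text \<open>
  A jump across the bond \<open>(j, j + 1)\<close>, of either process, changes only the factors \<open>j\<close> and \<open>j + 1\<close> of
  \<open>P_R\<close>, and conserves the height at every site other than \<open>j + 1\<close>; hence duality can be checked bond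
  by bond, for two sites.

  Up to a weight depending on \<open>n\<close> only, \<open>p_A\<close> is the coefficient of \<open>z\<^sup>n\<close> in
  \<open>G(z) = (a z, b z; q\<^sup>2)\<^sub>\<infinity> / (u z, v z; q\<^sup>2)\<^sub>\<infinity>\<close>. A dynamic jump multiplies \<open>a\<close> and divides \<open>b\<close> by
  \<open>q\<^sup>2\<close> (or conversely) in the left factor, and does the same to \<open>u\<close> and \<open>v\<close> in the right factor. This
  multiplies \<open>G\<close> by a rational function of \<open>z\<close>, and partial fractions show that the operators by which
  the ASIP generator acts on one site (multiplication by \<open>q\<^bsup>\<plusminus>2n\<^esup>\<close>, raising and lowering of \<open>n\<close>) are linear
  combinations of the identity and the two shifts, with coefficients independent of \<open>n\<close>. The right
  factor is reduced to the left one by inverting the base. Substituting these combinations, the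
  two-site duality becomes a comparison of nine coefficients.
\<close>

subsection \<open>Al-Salam--Chihara polynomials and their generating function\<close>

lemma q_poch_0 [simp]: "q_poch a r 0 = 1"
  by (simp add: q_poch_def)

lemma q_poch_Suc: "q_poch a r (Suc n) = q_poch a r n * (1 - a * r ^ n)"
  by (simp add: q_poch_def)

lemma q_poch_Suc_left: "q_poch a r (Suc n) = (1 - a) * q_poch (a * r) r n"
  unfolding q_poch_def by (subst prod.lessThan_Suc_shift) (simp add: mult_ac)

lemma q_poch_inverse_power_eq_0:
  assumes "r \<noteq> 0" "n < m"
  shows "q_poch (inverse r ^ n) r m = 0"
proof -
  have "1 - inverse r ^ n * r ^ n = 0"
    using assms(1) by (simp add: power_inverse)
  then show ?thesis
    unfolding q_poch_def using assms(2) by (auto intro!: prod_zero)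
qed

lemma q_poch_nonzero:
  assumes "\<And>i. i < n \<Longrightarrow> a * r ^ i \<noteq> 1"
  shows "q_poch a r n \<noteq> 0"
  using assms by (fastforce simp: q_poch_def)

text \<open>This is the terminating 3phi2 series with upper parameters r^(-n), A, B and lower
  parameters p, 0 at argument r. The factors in A and B are kept apart because they form the basis
  in which the recurrence below is proved.\<close>

definition asc_sum :: "real \<Rightarrow> real \<Rightarrow> real \<Rightarrow> real \<Rightarrow> nat \<Rightarrow> real" where
  "asc_sum r A B p n =
     (\<Sum>m\<le>n. q_poch (inverse r ^ n) r m * r ^ m / (q_poch p r m * q_poch r r m) *
               (q_poch A r m * q_poch B r m))"

text \<open>Terms past index n vanish, so the sums for neighbouring n can be given a common range
  and compared term by term.\<close>

lemma asc_sum_extend: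
  assumes "r \<noteq> 0" "n < N"
  shows "asc_sum r A B p n =
     (\<Sum>m<N. q_poch (inverse r ^ n) r m * r ^ m / (q_poch p r m * q_poch r r m) *
               (q_poch A r m * q_poch B r m))"
  unfolding asc_sum_def
  by (rule sum.mono_neutral_left) (use assms in \<open>auto simp: q_poch_inverse_power_eq_0\<close>)

lemma power_neq_1:
  fixes r :: real
  assumes "r > 0" "r \<noteq> 1" "n > 0"
  shows "r ^ n \<noteq> 1"
  using assms power_eq_1_iff[of r n] by (auto simp: power_eq_1_iff)

text \<open>In the basis (A;r)_m (B;r)_m multiplication by A + B is two-term (\<open>e_Suc\<close>),
  which reduces the three-term recurrence of the Al-Salam--Chihara polynomials to contiguity
  relations for the coefficients \<open>C\<close>. For n = 0 the truncated index n - 1 is harmless,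
  its factor 1 - r^n being 0.\<close>

lemma asc_sum_recurrence:
  fixes r :: real
  assumes r: "r > 0" "r \<noteq> 1" and p: "\<And>i. p * r ^ i \<noteq> 1" and AB: "A * B = a2"
  shows "(1 - p * r ^ n) * asc_sum r A B p (Suc n) =
         (A + B - (a2 + p) * r ^ n) * asc_sum r A B p n - a2 * (1 - r ^ n) * asc_sum r A B p (n - 1)"
proof -
  define e where "e m = q_poch A r m * q_poch B r m" for m
  define w where "w m = r ^ m / (q_poch p r m * q_poch r r m)" for m
  define C where "C n m = q_poch (inverse r ^ n) r m * w m" for n m
  define N where "N = Suc (Suc n)"
  have r0: "r \<noteq> 0" using r by simp
  have S: "asc_sum r A B p i = (\<Sum>m<N. C i m * e m)" if "i \<le> Suc n" for i
    by (subst asc_sum_extend[of r i N])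
       (use that r0 in \<open>auto simp: N_def C_def w_def e_def intro!: sum.cong\<close>)
  have e_Suc: "(A + B) * e m = (inverse (r ^ m) + a2 * r ^ m) * e m - inverse (r ^ m) * e (Suc m)" for m
  proof -
    have "r ^ m * ((A + B) * e m) = (1 + a2 * r ^ m * r ^ m) * e m - e (Suc m)"
      by (simp add: e_def q_poch_Suc AB[symmetric] algebra_simps)
    then have "(A + B) * e m = inverse (r ^ m) * ((1 + a2 * r ^ m * r ^ m) * e m - e (Suc m))"
      using r0 by (simp add: field_simps)
    also have "\<dots> = (inverse (r ^ m) + a2 * r ^ m) * e m - inverse (r ^ m) * e (Suc m)"
      using r0 by (simp add: algebra_simps)
    finally show ?thesis .
  qed
  have rp: "r ^ Suc m \<noteq> 1" for m
    using power_neq_1[OF r, of "Suc m"] by simp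
  have w_Suc: "w (Suc m) * ((1 - p * r ^ m) * (1 - r ^ Suc m)) = r * w m" for m
  proof -
    have "q_poch p r m \<noteq> 0" by (intro q_poch_nonzero p)
    moreover have "q_poch r r m \<noteq> 0"
      using rp by (intro q_poch_nonzero) auto
    moreover have "1 - p * r ^ m \<noteq> 0" using p[of m] by simp
    moreover have "1 - r ^ Suc m \<noteq> 0" using rp[of m] by simp
    ultimately show ?thesis
      unfolding w_def q_poch_Suc
      by (simp add: divide_simps)
  qed
  \<comment> \<open>\<open>part1\<close> disposes of the terms with factor \<open>a2\<close>, where
    \<open>C (n - 1)\<close> occurs; \<open>part2\<close> and \<open>part2'\<close> match the
    remaining ones with \<open>C (Suc n)\<close>.\<close>
  have part1: "(r ^ m - r ^ n) * C n m = (1 - r ^ n) * C (n - 1) m" for m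
  proof (cases n)
    case 0
    then show ?thesis using r0 q_poch_inverse_power_eq_0[of r 0 m]
      by (cases m) (auto simp: C_def q_poch_inverse_power_eq_0)
  next
    case (Suc l)
    have "inverse r ^ n * r = inverse r ^ l"
      using r0 Suc by simp
    then have "q_poch (inverse r ^ n) r m * (1 - inverse r ^ n * r ^ m)
        = (1 - inverse r ^ n) * q_poch (inverse r ^ l) r m"
      using q_poch_Suc[of "inverse r ^ n" r m] q_poch_Suc_left[of "inverse r ^ n" r m]
      by (simp only: )
    then have "r ^ n * (q_poch (inverse r ^ n) r m * (1 - inverse r ^ n * r ^ m))
        = r ^ n * ((1 - inverse r ^ n) * q_poch (inverse r ^ l) r m)" by simp
    moreover have "r ^ n * (x * (1 - inverse r ^ n * y)) = x * (r ^ n - y)" for x y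
      using r0 by (simp add: field_simps)
    moreover have "r ^ n * ((1 - inverse r ^ n) * x) = (r ^ n - 1) * x" for x
      using r0 by (simp add: field_simps)
    ultimately have "q_poch (inverse r ^ n) r m * (r ^ n - r ^ m)
        = (r ^ n - 1) * q_poch (inverse r ^ l) r m"
      by (simp only:)
    moreover have "Q * (x - y) = (x - 1) * P \<Longrightarrow> (y - x) * (Q * z) = (1 - x) * (P * z)"
      for P Q x y z :: real by algebra
    ultimately show ?thesis unfolding C_def using Suc by simp
  qed
  have part2: "(1 - p * r ^ n) * C (Suc n) (Suc m) =
      (inverse (r ^ Suc m) - p * r ^ n) * C n (Suc m) - inverse (r ^ m) * C n m" for m
  proof -
    define E where "E = q_poch (inverse r ^ n) r m"
    have 1: "q_poch (inverse r ^ Suc n) r (Suc m) = (1 - inverse r ^ Suc n) * E"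
    proof -
      have "inverse r ^ Suc n * r = inverse r ^ n" using r0 by simp
      then show ?thesis by (simp only: q_poch_Suc_left E_def)
    qed
    have 2: "q_poch (inverse r ^ n) r (Suc m) = E * (1 - inverse r ^ n * r ^ m)"
      by (simp add: q_poch_Suc E_def)
    have 3: "w m = w (Suc m) * ((1 - p * r ^ m) * (1 - r ^ Suc m)) / r"
      using w_Suc[of m] r0 by simp
    show ?thesis unfolding C_def 1 2 E_def[symmetric] 3 using r0
      by (simp add: field_simps power_inverse)
  qed
  have part2': "(1 - p * r ^ n) * C (Suc n) 0 = (inverse (r ^ 0) - p * r ^ n) * C n 0"
    by (simp add: C_def)
  have "(A + B) * asc_sum r A B p n = (\<Sum>m<N. C n m * ((A + B) * e m))"
    by (simp add: S sum_distrib_left mult_ac)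
  also have "\<dots> = (\<Sum>m<N. (inverse (r ^ m) + a2 * r ^ m) * C n m * e m)
                 - (\<Sum>m<N. inverse (r ^ m) * C n m * e (Suc m))"
    unfolding e_Suc sum_subtractf[symmetric] by (intro sum.cong) (auto simp: algebra_simps)
  \<comment> \<open>The last index m = n + 1 contributes nothing, so the shift from m to m + 1 stays
    within the range N = n + 2.\<close>
  also have "(\<Sum>m<N. inverse (r ^ m) * C n m * e (Suc m))
           = (\<Sum>m<Suc n. inverse (r ^ m) * C n m * e (Suc m))"
    by (simp add: N_def C_def q_poch_inverse_power_eq_0 r0)
  finally have eq: "(A + B - (a2 + p) * r ^ n) * asc_sum r A B p n
           - a2 * (1 - r ^ n) * asc_sum r A B p (n - 1)
        = (\<Sum>m<N. (inverse (r ^ m) + a2 * r ^ m) * C n m * e m)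
          - (\<Sum>m<Suc n. inverse (r ^ m) * C n m * e (Suc m))
          - (a2 + p) * r ^ n * (\<Sum>m<N. C n m * e m) - a2 * (1 - r ^ n) * (\<Sum>m<N. C (n - 1) m * e m)"
    by (simp add: S algebra_simps)
  also have "\<dots> = (\<Sum>m<N. (inverse (r ^ m) - p * r ^ n) * C n m * e m
            + a2 * ((r ^ m - r ^ n) * C n m - (1 - r ^ n) * C (n - 1) m) * e m)
          - (\<Sum>m<Suc n. inverse (r ^ m) * C n m * e (Suc m))"
    by (simp only: sum_distrib_left sum.distrib sum_subtractf algebra_simps)
  also have "\<dots> = (\<Sum>m<N. (inverse (r ^ m) - p * r ^ n) * C n m * e m)
          - (\<Sum>m<Suc n. inverse (r ^ m) * C n m * e (Suc m))"
    by (simp add: part1)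
  also have "\<dots> = (1 - p * r ^ n) * C (Suc n) 0 * e 0 +
      (\<Sum>m<Suc n. ((inverse (r ^ Suc m) - p * r ^ n) * C n (Suc m) - inverse (r ^ m) * C n m) * e (Suc m))"
    unfolding N_def part2'
    by (subst sum.lessThan_Suc_shift) (simp add: algebra_simps sum.distrib sum_subtractf del: sum.lessThan_Suc)
  also have "\<dots> = (\<Sum>m<N. (1 - p * r ^ n) * C (Suc n) m * e m)"
    unfolding N_def part2[symmetric] by (subst (2) sum.lessThan_Suc_shift) simp
  also have "\<dots> = (1 - p * r ^ n) * asc_sum r A B p (Suc n)"
    by (simp add: S sum_distrib_left mult_ac)
  finally show ?thesis ..
qed

section \<open>Coefficients of the generating function and their recurrence\<close>

text \<open>
  \<open>asc r a b u v n\<close> is the coefficient of \<open>z\<^sup>n\<close> in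
  \<open>G(z) = (a z; r)\<^sub>\<infinity> (b z; r)\<^sub>\<infinity> / ((u z; r)\<^sub>\<infinity> (v z; r)\<^sub>\<infinity>)\<close>; the recurrence expresses
  \<open>(1 - a z) (1 - b z) G(r z) = (1 - u z) (1 - v z) G(z)\<close>.
\<close>

fun asc :: "real \<Rightarrow> real \<Rightarrow> real \<Rightarrow> real \<Rightarrow> real \<Rightarrow> nat \<Rightarrow> real" where
  "asc r a b u v 0 = 1"
| "asc r a b u v (Suc 0) = (u + v - a - b) / (1 - r)"
| "asc r a b u v (Suc (Suc n)) =
     ((u + v - (a + b) * r ^ Suc n) * asc r a b u v (Suc n) - (u * v - a * b * r ^ n) * asc r a b u v n)
     / (1 - r ^ Suc (Suc n))"

text \<open>The lowering term of the recurrence, with value 0 at n = 0, where a coefficient of index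
  -1 would stand. It merges the separate base case of \<open>asc\<close> into the uniform relation
  \<open>asc_Suc\<close>.\<close>

definition asc_low :: "real \<Rightarrow> real \<Rightarrow> real \<Rightarrow> real \<Rightarrow> real \<Rightarrow> nat \<Rightarrow> real" where
  "asc_low r a b u v n = (case n of 0 \<Rightarrow> 0 | Suc m \<Rightarrow> (u * v - a * b * r ^ m) * asc r a b u v m)"

lemma asc_low_simps [simp]:
  "asc_low r a b u v 0 = 0"
  "asc_low r a b u v (Suc n) = (u * v - a * b * r ^ n) * asc r a b u v n"
  by (simp_all add: asc_low_def)

lemma asc_Suc:
  assumes "r > 0" "r \<noteq> 1"
  shows "(1 - r ^ Suc n) * asc r a b u v (Suc n) =
         (u + v - (a + b) * r ^ n) * asc r a b u v n - asc_low r a b u v n"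
proof (cases n)
  case (Suc m)
  have "1 - r ^ Suc (Suc m) \<noteq> 0"
    using power_neq_1[OF assms, of "Suc (Suc m)"] by simp
  then show ?thesis unfolding Suc asc.simps asc_low_simps by simp
qed (use assms in simp)

lemma asc_eqI:
  assumes r: "r > 0" "r \<noteq> 1" and f0: "f 0 = 1" and f1: "(1 - r) * f 1 = u + v - a - b"
    and f2: "\<And>n. (1 - r ^ Suc (Suc n)) * f (Suc (Suc n)) =
         (u + v - (a + b) * r ^ Suc n) * f (Suc n) - (u * v - a * b * r ^ n) * f n"
  shows "f n = asc r a b u v n"
proof (induction n rule: induct_nat_012)
  case (ge2 n)
  have "1 - r ^ Suc (Suc n) \<noteq> 0"
    using power_neq_1[OF r, of "Suc (Suc n)"] by simp
  then show ?case
    using f2[of n] ge2 unfolding asc.simps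
    by (simp only: nonzero_eq_divide_eq mult.commute[of _ "1 - r ^ Suc (Suc n)"] not_False_eq_True simp_thms)
next
  case 1
  then show ?case using f1 r by (simp add: nonzero_eq_divide_eq mult.commute)
qed (simp add: f0)

text \<open>Replacing z by z/r in (1 - a z) (1 - b z) G(r z) = (1 - u z) (1 - v z) G(z) gives an
  equation of the same kind in base 1/r, with numerator and denominator parameters exchanged and
  divided by r. This turns the denominator parameters of the right factor into numerator
  ones.\<close>

lemma asc_inverse_base:
  assumes "r > 0" "r \<noteq> 1"
  shows "asc (1 / r) (u / r) (v / r) (a / r) (b / r) n = asc r a b u v n"
proof (rule asc_eqI[OF assms])
  have r: "1 / r > 0" "1 / r \<noteq> 1" using assms by auto
  let ?f = "asc (1 / r) (u / r) (v / r) (a / r) (b / r)"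
  have "(1 - r) * ((a / r + b / r - u / r - v / r) / (1 - 1 / r)) = u + v - a - b"
    using assms by (simp add: divide_simps) (simp add: algebra_simps)
  then show "(1 - r) * ?f 1 = u + v - a - b" by simp
  fix n
  have "(1 - (1 / r) ^ Suc (Suc n)) * ?f (Suc (Suc n)) =
     (a / r + b / r - (u / r + v / r) * (1 / r) ^ Suc n) * ?f (Suc n)
     - (a / r * (b / r) - u / r * (v / r) * (1 / r) ^ n) * ?f n"
    using asc_Suc[OF r, of "Suc n" "u / r" "v / r" "a / r" "b / r"] unfolding asc_low_simps .
  then have "r ^ Suc (Suc n) * ((1 - (1 / r) ^ Suc (Suc n)) * ?f (Suc (Suc n))) =
     r ^ Suc (Suc n) * ((a / r + b / r - (u / r + v / r) * (1 / r) ^ Suc n) * ?f (Suc n)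
     - (a / r * (b / r) - u / r * (v / r) * (1 / r) ^ n) * ?f n)" by (simp only:)
  moreover have "r ^ Suc (Suc n) * ((1 - (1 / r) ^ Suc (Suc n)) * x) = - ((1 - r ^ Suc (Suc n)) * x)" for x
    using assms by (simp add: field_simps)
  moreover have "r ^ Suc (Suc n) * ((a / r + b / r - (u / r + v / r) * (1 / r) ^ Suc n) * x
     - (a / r * (b / r) - u / r * (v / r) * (1 / r) ^ n) * y) =
     - ((u + v - (a + b) * r ^ Suc n) * x - (u * v - a * b * r ^ n) * y)" for x y
    using assms by (simp add: field_simps)
  ultimately show "(1 - r ^ Suc (Suc n)) * ?f (Suc (Suc n)) =
     (u + v - (a + b) * r ^ Suc n) * ?f (Suc n) - (u * v - a * b * r ^ n) * ?f n"
    by (simp only: neg_equal_iff_equal)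
qed simp

lemma asc_swap: "asc r a b u v n = asc r b a u v n"
  by (induction n rule: induct_nat_012) (simp_all add: algebra_simps)

text \<open>Here x0 to x3 are consecutive coefficients of G for the pair r a, b, and R is a power of
  r. The recurrence at one index minus a times the one before, regrouped, is the recurrence for the
  pair a, b, now satisfied by the coefficients of (1 - a z) G.\<close>

lemma contract_algebra:
  fixes r a b u v R x3 x2 x1 x0 :: real
  assumes "(1 - r * (r * (r * R))) * x3 = (u + v - (r * a + b) * (r * (r * R))) * x2 - (u * v - r * a * b * (r * R)) * x1"
    "(1 - r * (r * R)) * x2 = (u + v - (r * a + b) * (r * R)) * x1 - (u * v - r * a * b * R) * x0"
  shows "(1 - r * (r * (r * R))) * (x3 - a * x2) = (u + v - (a + b) * (r * (r * R))) * (x2 - a * x1)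
    - (u * v - a * b * (r * R)) * (x1 - a * x0)"
proof -
  have "?thesis \<longleftrightarrow> (1 - r * (r * (r * R))) * x3 - a * ((1 - r * (r * R)) * x2) + (a * (r * (r * R) * (r-1))) * x2 = (u + v - (a + b) * (r * (r * R))) * (x2 - a * x1)
    - (u * v - a * b * (r * R)) * (x1 - a * x0)" by (simp add: algebra_simps)
  also have \<dots> unfolding assms by (simp add: algebra_simps)
  finally show ?thesis by simp
qed

text \<open>
  The next two lemmas read \<open>(1 - a z) G\<^sub>r\<^sub>a\<^sub>,\<^sub>b(z) = G\<^sub>a\<^sub>,\<^sub>b(z)\<close> and
  \<open>(1 - a z) G\<^sub>r\<^sub>a\<^sub>,\<^sub>b\<^sub>/\<^sub>r(z) = (1 - b z / r) G\<^sub>a\<^sub>,\<^sub>b(z)\<close>.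
\<close>

lemma asc_contract:
  assumes r: "r > 0" "r \<noteq> 1"
  shows "asc r (r * a) b u v (Suc n) - a * asc r (r * a) b u v n = asc r a b u v (Suc n)"
proof -
  define G where "G = asc r (r * a) b u v"
  \<comment> \<open>\<open>W\<close> lists the coefficients of (1 - a z) G, to be identified through
    their recurrence by \<open>asc_eqI\<close>. The first instance is treated apart because
    \<open>W 0\<close> is not a difference.\<close>
  define W where "W n = (case n of 0 \<Rightarrow> 1 | Suc m \<Rightarrow> G (Suc m) - a * G m)" for n
  have G0: "G 0 = 1" by (simp add: G_def)
  have G1: "(1 - r) * G (Suc 0) = (u + v - (r * a + b)) * G 0"
    using asc_Suc[OF r, of 0 "r * a" b u v] unfolding G_def by simp
  have G2: "(1 - r * (r * r ^ n)) * G (Suc (Suc n)) =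
         (u + v - (r * a + b) * (r * r ^ n)) * G (Suc n) - (u * v - (r * a) * b * r ^ n) * G n" for n
    using asc_Suc[OF r, of "Suc n" "r * a" b u v] unfolding G_def asc_low_simps power_Suc .
  have "W n = asc r a b u v n" for n
  proof (rule asc_eqI[OF r])
    show "(1 - r) * W 1 = u + v - a - b"
      using G1 by (simp add: W_def G0 algebra_simps)
    fix n
    have "(1 - r * (r * r ^ n)) * W (Suc (Suc n)) =
         (u + v - (a + b) * (r * r ^ n)) * W (Suc n) - (u * v - a * b * r ^ n) * W n"
    proof (cases n)
      case 0
      show ?thesis using G1 G2[of 0] unfolding 0 W_def G0 nat.case power_0 by algebra
    next
      case (Suc m)
      show ?thesis using contract_algebra[OF G2[of "Suc m", unfolded power_Suc] G2[of m]]
        unfolding Suc W_def nat.case power_Suc .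
    qed
    then show "(1 - r ^ Suc (Suc n)) * W (Suc (Suc n)) =
         (u + v - (a + b) * r ^ Suc n) * W (Suc n) - (u * v - a * b * r ^ n) * W n"
      by simp
  qed (simp add: W_def)
  from this[of "Suc n"] show ?thesis by (simp add: W_def G_def)
qed

lemma asc_shift:
  assumes r: "r > 0" "r \<noteq> 1"
  shows "asc r (r * a) (b / r) u v (Suc n) - a * asc r (r * a) (b / r) u v n =
         asc r a b u v (Suc n) - b / r * asc r a b u v n"
  \<comment> \<open>Both sides equal the coefficient of index n + 1 for the pair a, b/r.\<close>
  using asc_contract[OF r, of a "b / r" u v n] asc_contract[OF r, of "b / r" a u v n] r
  by (simp add: asc_swap[of r b] asc_swap[of r "b / r"] del: asc.simps)

section \<open>Partial fractions in the numerator parameters\<close>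

text \<open>
  The factor is the residue coefficient in the partial fraction expansion of \<open>G(r z) / G(z)\<close> at
  \<open>z = 1 / a\<close>, divided by the one of \<open>G\<^sub>r\<^sub>a\<^sub>,\<^sub>b\<^sub>/\<^sub>r(z) / G(z)\<close>.
\<close>

definition asc_diff :: "real \<Rightarrow> real \<Rightarrow> real \<Rightarrow> real \<Rightarrow> real \<Rightarrow> nat \<Rightarrow> real" where
  "asc_diff r a b u v n = r * (a - u) * (a - v) / ((a - b) * (r * a - b)) *
     (asc r (r * a) (b / r) u v n - asc r a b u v n)"

lemma asc_diff_0 [simp]: "asc_diff r a b u v 0 = 0"
  by (simp add: asc_diff_def)

text \<open>G for the pair r a, b/r minus G for the pair a, b is (a - b/r) z / (1 - a z) times the
  latter. The simple pole at 1/a becomes a first-order recursion with ratio a, and the normalizing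
  factor leaves the residue coefficient (a - u) (a - v) / (a - b).\<close>

lemma asc_diff_Suc:
  assumes r: "r > 0" "r \<noteq> 1" and "a \<noteq> b" "r * a \<noteq> b"
  shows "asc_diff r a b u v (Suc n) =
    a * asc_diff r a b u v n + (a - u) * (a - v) / (a - b) * asc r a b u v n"
proof -
  define U where "U = asc r (r * a) (b / r) u v"
  define G where "G = asc r a b u v"
  define x where "x = r * (a - u) * (a - v) / ((a - b) * (r * a - b))"
  have "U (Suc n) - a * U n = G (Suc n) - b / r * G n"
    unfolding U_def G_def by (rule asc_shift[OF r])
  then have "x * (U (Suc n) - G (Suc n)) = a * (x * (U n - G n)) + x * (a - b / r) * G n"
    by algebra
  moreover have "x * (a - b / r) = (a - u) * (a - v) / (a - b)"
  proof -
    have "a - b / r = (r * a - b) / r" using r by (simp add: field_simps)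
    then show ?thesis unfolding x_def using assms by simp
  qed
  ultimately show ?thesis by (simp only: asc_diff_def U_def G_def x_def)
qed

text \<open>Coefficientwise, these are the partial fractions of G(r z) - G(z) and of -z (u v G(z) -
  a b G(r z)), with poles at 1/a and 1/b. They are proved jointly, since the induction step of the
  first uses the second.\<close>

lemma asc_diff_sums:
  assumes r: "r > 0" "r \<noteq> 1" and ab: "a \<noteq> b" "r * a \<noteq> b" "r * b \<noteq> a"
  shows "asc_diff r a b u v n + asc_diff r b a u v n = (r ^ n - 1) * asc r a b u v n \<and>
    b * asc_diff r a b u v n + a * asc_diff r b a u v n = - asc_low r a b u v n"
proof (induction n)
  case (Suc n)
  define g d e l where "g = asc r a b u v n" and "d = asc_diff r a b u v n"
    and "e = asc_diff r b a u v n" and "l = asc_low r a b u v n"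
  define c where "c = inverse (a - b)"
  have c: "(a - b) * c = 1" using ab by (simp add: c_def)
  define R where "R = r ^ n"
  have d: "asc_diff r a b u v (Suc n) = a * d + (a - u) * (a - v) * c * g"
    unfolding d_def g_def c_def by (simp add: asc_diff_Suc[OF r] ab divide_inverse)
  have "inverse (b - a) = - c"
    unfolding c_def by (metis inverse_minus_eq minus_diff_eq)
  then have e: "asc_diff r b a u v (Suc n) = b * e - (b - u) * (b - v) * c * g"
    unfolding e_def g_def
    using asc_diff_Suc[OF r, of b a u v n] ab by (simp add: divide_inverse asc_swap[of r b a])
  have g: "(1 - r * R) * asc r a b u v (Suc n) = (u + v - (a + b) * R) * g - l"
    using asc_Suc[OF r, of n a b u v] unfolding g_def l_def power_Suc R_def .
  have IH: "d + e = (R - 1) * g" "b * d + a * e = - l"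
    using Suc unfolding d_def e_def g_def l_def R_def by auto
  have "asc_diff r a b u v (Suc n) + asc_diff r b a u v (Suc n) = (r * R - 1) * asc r a b u v (Suc n)"
    unfolding d e using g IH c by algebra
  moreover have "b * asc_diff r a b u v (Suc n) + a * asc_diff r b a u v (Suc n) = - asc_low r a b u v (Suc n)"
    unfolding d e asc_low_simps g_def[symmetric] R_def[symmetric] using IH(1) c by algebra
  ultimately show ?case by (simp add: R_def)
qed simp

text \<open>The two identities of \<open>asc_diff_sums\<close> eliminate r^n times the coefficient,
  and the lowering term, from \<open>asc_Suc\<close>.\<close>

lemma asc_raise:
  assumes r: "r > 0" "r \<noteq> 1" and ab: "a \<noteq> b" "r * a \<noteq> b" "r * b \<noteq> a"
  shows "(1 - r ^ Suc n) * asc r a b u v (Suc n) =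
    (u + v - a - b) * asc r a b u v n - a * asc_diff r a b u v n - b * asc_diff r b a u v n"
proof -
  define R d e x where "R = r ^ n" and "d = asc_diff r a b u v n" and "e = asc_diff r b a u v n"
    and "x = asc r a b u v (Suc n)"
  show ?thesis
    using asc_Suc[OF r, of n a b u v] asc_diff_sums[OF r ab, of u v n]
    unfolding power_Suc R_def[symmetric] d_def[symmetric] e_def[symmetric] x_def[symmetric] by algebra
qed

section \<open>Identification of \<open>p_A\<close> with the generating-function
  coefficients\<close>

lemma asc_eq_asc_sum:
  assumes r: "r > 0" "r \<noteq> 1" and p: "\<And>i. a * b * r ^ i \<noteq> 1" and a: "a \<noteq> 0" and uv: "u * v = 1"
  shows "asc r a b u v n =
    q_poch (a * b) r n / (q_poch r r n * a ^ n) * asc_sum r (a * v) (a * u) (a * b) n"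
proof (rule asc_eqI[OF r, symmetric])
  define S where "S = asc_sum r (a * v) (a * u) (a * b)"
  define P where "P = q_poch (a * b) r"
  define R where "R = q_poch r r"
  let ?f = "\<lambda>n. P n / (R n * a ^ n) * S n"
  \<comment> \<open>Since u v = 1, the parameters a v and a u have product a^2 and sum a (u + v), so
    the recurrence of \<open>asc_sum\<close> is that of \<open>asc\<close> up to the prefactor in
    \<open>?f\<close>.\<close>
  have S: "(1 - a * b * r ^ n) * S (Suc n) =
      a * (u + v - (a + b) * r ^ n) * S n - a * a * (1 - r ^ n) * S (n - 1)" for n
    using asc_sum_recurrence[OF r p, of "a * v" "a * u" "a * a" n] uv
    unfolding S_def by (simp add: algebra_simps)
  have S0: "S 0 = 1" by (simp add: S_def asc_sum_def)
  have P: "P (Suc n) = P n * (1 - a * b * r ^ n)" for n by (simp add: P_def q_poch_Suc)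
  have R: "R (Suc n) = R n * (1 - r ^ Suc n)" for n by (simp add: R_def q_poch_Suc)
  have rn: "1 - r ^ Suc n \<noteq> 0" for n using power_neq_1[OF r, of "Suc n"] by simp
  have Rn: "R n \<noteq> 0" for n by (induction n) (use R rn in \<open>simp_all add: R_def\<close>)
  have f: "(1 - r ^ Suc n) * ?f (Suc n) = P n / (R n * a ^ Suc n) * ((1 - a * b * r ^ n) * S (Suc n))" for n
    using rn[of n] by (simp add: P R)
  show "q_poch (a * b) r 0 / (q_poch r r 0 * a ^ 0) * asc_sum r (a * v) (a * u) (a * b) 0 = 1"
    by (simp add: asc_sum_def)
  have "(1 - r ^ Suc 0) * ?f (Suc 0) = u + v - a - b"
    unfolding f S using a by (simp add: S0 P_def R_def)
  then show "(1 - r) * (q_poch (a * b) r 1 / (q_poch r r 1 * a ^ 1) * asc_sum r (a * v) (a * u) (a * b) 1)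
      = u + v - a - b"
    by (simp add: S_def P_def R_def)
  fix n
  have "(1 - r ^ Suc (Suc n)) * ?f (Suc (Suc n)) =
       P (Suc n) / (R (Suc n) * a ^ Suc (Suc n)) * (a * (u + v - (a + b) * r ^ Suc n) * S (Suc n))
       - P (Suc n) / (R (Suc n) * a ^ Suc (Suc n)) * (a * a * (1 - r ^ Suc n) * S n)"
    unfolding f S by (simp add: right_diff_distrib)
  also have "\<dots> = (u + v - (a + b) * r ^ Suc n) * ?f (Suc n) - (u * v - a * b * r ^ n) * ?f n"
  proof (intro arg_cong2[of _ _ _ _ "(-)"])
    show "P (Suc n) / (R (Suc n) * a ^ Suc (Suc n)) * (a * (u + v - (a + b) * r ^ Suc n) * S (Suc n)) =
       (u + v - (a + b) * r ^ Suc n) * ?f (Suc n)"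
      using a by simp
    show "P (Suc n) / (R (Suc n) * a ^ Suc (Suc n)) * (a * a * (1 - r ^ Suc n) * S n) =
       (u * v - a * b * r ^ n) * ?f n"
      using rn[of n] a by (simp add: P R uv)
  qed
  finally show "(1 - r ^ Suc (Suc n)) * (q_poch (a * b) r (Suc (Suc n)) / (q_poch r r (Suc (Suc n)) * a ^ Suc (Suc n)) *
         asc_sum r (a * v) (a * u) (a * b) (Suc (Suc n))) =
      (u + v - (a + b) * r ^ Suc n) * (q_poch (a * b) r (Suc n) / (q_poch r r (Suc n) * a ^ Suc n) *
         asc_sum r (a * v) (a * u) (a * b) (Suc n))
      - (u * v - a * b * r ^ n) * (q_poch (a * b) r n / (q_poch r r n * a ^ n) * asc_sum r (a * v) (a * u) (a * b) n)"
    by (simp add: S_def P_def R_def)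
qed

lemma phi32_eq_asc_sum:
  assumes "r \<noteq> 0"
  shows "phi32 (inverse r ^ n) A B p 0 r r = asc_sum r A B p n"
proof -
  have [simp]: "q_poch 0 r m = 1" for m by (simp add: q_poch_def)
  show ?thesis unfolding phi32_def asc_sum_def
    by (subst suminf_finite[of "{..n}"])
       (auto simp: q_poch_inverse_power_eq_0[OF assms] mult_ac intro!: sum.cong)
qed

text \<open>Up to a power of q this is (q^2; q^2)_n / (q^(2k); q^2)_n. In terms of q-numbers it can
  be moved past the jump rates, see \<open>asc_weight_Suc\<close>.\<close>

definition asc_weight :: "real \<Rightarrow> real \<Rightarrow> nat \<Rightarrow> real" where
  "asc_weight q k n = (\<Prod>i<n. q_num q (real i + 1) / q_num q (real i + k))"

lemma q_minus_inverse_neq_0: "q > 0 \<Longrightarrow> q \<noteq> 1 \<Longrightarrow> q - inverse q \<noteq> (0 :: real)"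
  by (auto simp: field_simps power2_eq_square[symmetric] power2_eq_1_iff)

lemma q_num_alt:
  assumes "q > 0"
  shows "q_num q a = q powr (- a) * (q powr (2 * a) - 1) / (q - inverse q)"
  by (simp add: q_num_def right_diff_distrib powr_add[symmetric])

lemma powr_eq_1_iff_exponent:
  assumes "q > 0" "q \<noteq> (1::real)"
  shows "q powr a = 1 \<longleftrightarrow> a = 0"
  using assms by (simp add: powr_def)

lemma q_num_eq_0_iff:
  assumes "q > 0" "q \<noteq> 1"
  shows "q_num q a = 0 \<longleftrightarrow> a = 0"
  using assms q_minus_inverse_neq_0[OF assms] by (auto simp: q_num_alt powr_eq_1_iff_exponent)

lemma square_powr: "q > 0 \<Longrightarrow> (q\<^sup>2) ^ n = q powr (2 * real n)" for q :: real
  using powr_realpow[of q "2 * n"] by (simp add: power_mult)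

text \<open>Besides k, the pair a, b involves only the height h to the right of the site, and the
  pair u, v only the height h + 2x + k to its left. A dynamic jump changes just the height between
  two sites, hence only a, b of the left factor and u, v of the right one.\<close>

lemma p_A_eq_asc:
  assumes q: "q > 0" "q \<noteq> 1" and k: "k > 0"
  shows "p_A q n x h k = q powr (- (real n * (k - 1) / 2)) * asc_weight q k n *
    asc (q\<^sup>2) (q powr (k + h)) (q powr (k - h)) (q powr (h + 2 * real x + k)) (q powr (- (h + 2 * real x + k))) n"
proof -
  define r a b u v where "r = q\<^sup>2" and "a = q powr (k + h)" and "b = q powr (k - h)"
    and "u = q powr (h + 2 * real x + k)" and "v = q powr (- (h + 2 * real x + k))"
  have r: "r > 0" "r \<noteq> 1"
    using q by (auto simp: r_def power2_eq_1_iff)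
  have ab: "a * b = q powr (2 * k)" by (simp add: a_def b_def powr_add[symmetric])
  have rpow: "r ^ n = q powr (2 * real n)" for n unfolding r_def using q by (rule_tac square_powr) auto
  have p: "a * b * r ^ i \<noteq> 1" for i
  proof -
    have "a * b * r ^ i = q powr (2 * k + 2 * real i)" by (simp add: ab rpow powr_add)
    then show ?thesis using powr_eq_1_iff_exponent[OF q] k by simp
  qed
  have a0: "a \<noteq> 0" and uv: "u * v = 1" using q by (simp_all add: a_def u_def v_def powr_add[symmetric])
  have rn: "1 - r ^ Suc n \<noteq> 0" for n using power_neq_1[OF r, of "Suc n"] by simp
  have Rn: "q_poch r r n \<noteq> 0" for n
    using rn by (intro q_poch_nonzero) (simp add: r_def)
  have Pn: "q_poch (a * b) r n \<noteq> 0" for n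
    using p by (intro q_poch_nonzero)
  have au: "a * u = q powr (2 * real x + 2 * h + 2 * k)" and av: "a * v = q powr (- 2 * real x)"
    by (simp_all add: a_def u_def v_def powr_add[symmetric] algebra_simps)
  have "p_A q n x h k = q powr (- (1 / 2) * real n * (2 * h + k + 1)) * asc_sum r (a * v) (a * u) (a * b) n"
  proof -
    have "q powr (- 2 * real n) = inverse r ^ n"
      by (simp add: rpow power_inverse powr_minus)
    then show ?thesis unfolding p_A_def
      using phi32_eq_asc_sum[of r n "a * v" "a * u" "a * b"] r by (simp add: au av ab r_def)
  qed
  also have "asc_sum r (a * v) (a * u) (a * b) n = q_poch r r n * a ^ n / q_poch (a * b) r n * asc r a b u v n"
    unfolding asc_eq_asc_sum[OF r p a0 uv] using Rn[of n] Pn[of n] a0 by simp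
  also have "q_poch r r n = q_poch (a * b) r n * (q powr (real n * (1 - k)) * asc_weight q k n)"
  proof (induction n)
    case (Suc n)
    have "q_num q (real n + 1) * (1 - q powr (2 * (real n + k))) = q powr (k - 1) * (1 - q powr (2 * (real n + 1))) * q_num q (real n + k)"
      using q_minus_inverse_neq_0[OF q] q
      by (simp add: q_num_alt) (simp add: field_simps powr_add powr_minus powr_diff)
    moreover have "q_num q (real n + k) \<noteq> 0" using k by (simp add: q_num_eq_0_iff[OF q])
    ultimately have *: "(1 - q powr (2 * (real n + k))) * (q powr (1 - k) * (q_num q (real n + 1) / q_num q (real n + k))) = 1 - q powr (2 * (real n + 1))"
      using q by (simp add: field_simps powr_diff)
    have "q_poch (a * b) r (Suc n) = q_poch (a * b) r n * (1 - q powr (2 * (real n + k)))"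
      by (simp add: q_poch_Suc ab rpow powr_add[symmetric] algebra_simps)
    moreover have "q_poch r r (Suc n) = q_poch r r n * (1 - q powr (2 * (real n + 1)))"
    proof -
      have "r * r ^ n = q powr (2 * (real n + 1))"
        using rpow[of "Suc n"] by (simp add: algebra_simps)
      then show ?thesis by (simp add: q_poch_Suc)
    qed
    moreover have "asc_weight q k (Suc n) = asc_weight q k n * (q_num q (real n + 1) / q_num q (real n + k))"
      by (simp add: asc_weight_def)
    moreover have "q powr (real (Suc n) * (1 - k)) = q powr (real n * (1 - k)) * q powr (1 - k)"
      by (simp add: powr_add[symmetric] algebra_simps)
    ultimately show ?case
      unfolding *[symmetric] Suc using q by (simp add: mult_ac)
  qed (use q in \<open>simp add: asc_weight_def\<close>)
  finally have "p_A q n x h k = q powr (- (1 / 2) * real n * (2 * h + k + 1)) * a ^ n * q powr (real n * (1 - k))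
      * asc_weight q k n * asc r a b u v n"
    using Pn[of n] by simp
  \<comment> \<open>The power of a cancels the h in the normalization of \<open>p_A\<close>; the
    remaining prefactor depends only on n and k.\<close>
  also have "q powr (- (1 / 2) * real n * (2 * h + k + 1)) * a ^ n * q powr (real n * (1 - k)) =
      q powr (- (real n * (k - 1) / 2))"
  proof -
    have "a ^ n = q powr (real n * (k + h))"
      using q by (simp add: a_def powr_realpow[symmetric] powr_powr mult.commute)
    then show ?thesis
      by (simp only: powr_add[symmetric]) (rule arg_cong[of _ _ "(powr) q"], simp add: field_simps)
  qed
  finally show ?thesis by (simp add: r_def a_def b_def u_def v_def)
qed

subsection \<open>Two sites\<close>

text \<open>\<open>L1\<close>, \<open>R1\<close>, \<open>X\<close> stand for lowering, raising and
  multiplication by q^(2n) on the left factor \<open>g\<close>, with differences \<open>dp\<close>,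
  \<open>dm\<close>; \<open>L2\<close>, \<open>R2\<close>, \<open>Y\<close> are their analogues on
  the right factor \<open>v\<close> in base q^(-2). \<alpha> and \<beta> are q^k for the two sites;
  t, s, c are q to the heights left of, between and right of them. Both sides are bilinear in (g,
  dp, dm) and (v, ep, em).\<close>

lemma bond_algebra:
  fixes q \<alpha> \<beta> s t c :: real
  assumes nz: "q \<noteq> 0" "\<alpha> \<noteq> 0" "\<beta> \<noteq> 0" "s \<noteq> 0" "t \<noteq> 0" "c \<noteq> 0"
    and L1: "L1 = - (\<alpha> / s * dp + \<alpha> * s * dm)"
    and R1: "R1 = (t + 1 / t - \<alpha> * s - \<alpha> / s) * g - \<alpha> * s * dp - \<alpha> / s * dm"
    and X: "(X - 1) * g = dp + dm"
    and L2: "L2 = - (1 / (s * q\<^sup>2) * ep + s / q\<^sup>2 * em)"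
    and R2: "R2 = (\<beta> * c / q\<^sup>2 + \<beta> / (c * q\<^sup>2) - s / q\<^sup>2 - 1 / (s * q\<^sup>2)) * v - s / q\<^sup>2 * ep - 1 / (s * q\<^sup>2) * em"
    and Y: "(Y - 1) * v = ep + em"
  shows "- (q / \<beta>) * L1 * R2 - q ^ 3 / \<beta> * R1 * L2
      - (\<alpha> / q * (X - 1) * (\<beta> - Y / \<beta>) + q / \<beta> * (1 - Y) * (\<alpha> * X - 1 / \<alpha>)) * (g * v) =
    - (\<alpha> / \<beta>) * ((s - 1 / s) * (q * s - 1 / (q * s))) * dp * em
    - \<alpha> / (s * q) * (\<beta> * s + 1 / (\<beta> * s) - c - 1 / c) * dp * v
    + q * s / \<beta> * (t + 1 / t - \<alpha> * s - 1 / (\<alpha> * s)) * g * em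
    - (\<alpha> / \<beta>) * ((s - 1 / s) * (s / q - q / s)) * dm * ep
    - \<alpha> * s / q * (s / \<beta> + \<beta> / s - c - 1 / c) * dm * v
    + q / (s * \<beta>) * (t + 1 / t - s / \<alpha> - \<alpha> / s) * g * ep"
proof -
  define dd d1 d2 where "dd = - \<alpha> / (q * \<beta>) - q * \<alpha> / \<beta>"
    and "d1 = \<alpha> / q * (\<beta> - 1 / \<beta>)" and "d2 = - (q / \<beta>) * (\<alpha> - 1 / \<alpha>)"
  define K Q a b a' b' z z' where "K = q / \<beta>" and "Q = q ^ 3 / \<beta>"
    and "a = \<alpha> * s" and "b = \<alpha> / s" and "a' = s / q\<^sup>2" and "b' = 1 / (s * q\<^sup>2)"
    and "z = t + 1 / t - a - b" and "z' = \<beta> * c / q\<^sup>2 + \<beta> / (c * q\<^sup>2) - a' - b'"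
  note defs = dd_def d1_def d2_def K_def Q_def a_def b_def a'_def b'_def z_def z'_def
  \<comment> \<open>The diagonal rate vanishes at X = Y = 1, so its expansion in X - 1 and Y - 1 has
    no constant term and no term in \<open>g * v\<close> alone.\<close>
  have diag: "(\<alpha> / q * (X - 1) * (\<beta> - Y / \<beta>) + q / \<beta> * (1 - Y) * (\<alpha> * X - 1 / \<alpha>)) * (g * v) =
     dd * (((X - 1) * g) * ((Y - 1) * v)) + d1 * (((X - 1) * g) * v) + d2 * (g * ((Y - 1) * v))"
    unfolding defs using nz by (simp add: field_simps)
  have bilinear: "- K * (- (b * dp + a * dm)) * (z' * v - a' * ep - b' * em)
     - Q * (z * g - a * dp - b * dm) * (- (b' * ep + a' * em))
     - (dd * ((dp + dm) * (ep + em)) + d1 * ((dp + dm) * v) + d2 * (g * (ep + em))) =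
     (- K * b * b' - Q * a * a' - dd) * dp * em + (K * b * z' - d1) * dp * v + (Q * z * a' - d2) * g * em
     + (- K * a * a' - Q * b * b' - dd) * dm * ep + (K * a * z' - d1) * dm * v + (Q * z * b' - d2) * g * ep
     + (- K * b * a' - Q * a * b' - dd) * dp * ep + (- K * a * b' - Q * b * a' - dd) * dm * em"
    by (simp add: algebra_simps)
  \<comment> \<open>The last two vanish: \<open>dp * ep\<close> and \<open>dm * em\<close> would
    shift the middle height in opposite directions in the two factors.\<close>
  have coeffs:
    "- K * b * b' - Q * a * a' - dd = - (\<alpha> / \<beta>) * ((s - 1 / s) * (q * s - 1 / (q * s)))"
    "K * b * z' - d1 = - (\<alpha> / (s * q) * (\<beta> * s + 1 / (\<beta> * s) - c - 1 / c))"
    "Q * z * a' - d2 = q * s / \<beta> * (t + 1 / t - \<alpha> * s - 1 / (\<alpha> * s))"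
    "- K * a * a' - Q * b * b' - dd = - (\<alpha> / \<beta> * ((s - 1 / s) * (s / q - q / s)))"
    "K * a * z' - d1 = - (\<alpha> * s / q * (s / \<beta> + \<beta> / s - c - 1 / c))"
    "Q * z * b' - d2 = q / (s * \<beta>) * (t + 1 / t - s / \<alpha> - \<alpha> / s)"
    "- K * b * a' - Q * a * b' - dd = 0" "- K * a * b' - Q * b * a' - dd = 0"
    unfolding defs using nz by (simp_all add: field_simps power2_eq_square power3_eq_cube)
  have L1': "L1 = - (b * dp + a * dm)" unfolding L1 a_def b_def ..
  have R1': "R1 = z * g - a * dp - b * dm" unfolding R1 z_def a_def b_def ..
  have L2': "L2 = - (b' * ep + a' * em)" unfolding L2 a'_def b'_def ..
  have R2': "R2 = z' * v - a' * ep - b' * em" unfolding R2 z'_def a'_def b'_def ..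
  show ?thesis
    unfolding diag X Y unfolding L1' R1' L2' R2'
    unfolding K_def[symmetric] Q_def[symmetric] bilinear
    unfolding coeffs
    by (simp only: mult_minus_left mult_zero_left add_0_right add_uminus_conv_diff)
qed

text \<open>This is two-site duality multiplied by (q - 1/q)^2 and stripped of the weights in n: the
  ASIP on the left, the dynamic process with its rates in terms of s, t, c on the right. The
  conditions on s keep the poles of the partial fractions apart; they exclude the middle heights 0,
  -1 and 1.\<close>

lemma asc_bond:
  fixes q \<alpha> \<beta> s t c :: real
  assumes q: "q > 0" "q \<noteq> 1" and nz: "\<alpha> \<noteq> 0" "\<beta> \<noteq> 0" "s \<noteq> 0" "t \<noteq> 0" "c \<noteq> 0"
    and s: "s\<^sup>2 \<noteq> 1" "q\<^sup>2 * s\<^sup>2 \<noteq> 1" "s\<^sup>2 \<noteq> q\<^sup>2"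
  defines "r \<equiv> q\<^sup>2"
  defines "G \<equiv> \<lambda>\<sigma>. asc r (\<alpha> * \<sigma>) (\<alpha> / \<sigma>) t (1 / t)"
    and "V \<equiv> \<lambda>\<sigma>. asc r (\<beta> * c) (\<beta> / c) \<sigma> (1 / \<sigma>)"
  shows "- (q / \<beta>) * asc_low r (\<alpha> * s) (\<alpha> / s) t (1 / t) m * ((1 - (1 / r) ^ Suc n) * V s (Suc n))
      - q ^ 3 / \<beta> * ((1 - r ^ Suc m) * G s (Suc m)) *
          asc_low (1 / r) (s / r) (1 / s / r) (\<beta> * c / r) (\<beta> / c / r) n
      - (\<alpha> / q * (r ^ m - 1) * (\<beta> - (1 / r) ^ n / \<beta>) +
         q / \<beta> * (1 - (1 / r) ^ n) * (\<alpha> * r ^ m - 1 / \<alpha>)) * (G s m * V s n) =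
    (t + 1 / t - \<alpha> * s - 1 / (\<alpha> * s)) * (\<beta> * s + 1 / (\<beta> * s) - c - 1 / c)
      / ((s - 1 / s) * (q * s - 1 / (q * s))) * (G (r * s) m * V (r * s) n - G s m * V s n) +
    (t + 1 / t - s / \<alpha> - \<alpha> / s) * (s / \<beta> + \<beta> / s - c - 1 / c)
      / ((s - 1 / s) * (s / q - q / s)) * (G (s / r) m * V (s / r) n - G s m * V s n)"
proof -
  have r: "r > 0" "r \<noteq> 1" and r': "1 / r > 0" "1 / r \<noteq> 1"
    using q by (auto simp: r_def power2_eq_1_iff)
  have q0: "q \<noteq> 0" using q by simp
  have ne: "s \<noteq> 1 / s" "q * s \<noteq> 1 / (q * s)" "s / q \<noteq> q / s"
    using s nz q0 by (auto simp: field_simps power2_eq_square)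
  define a b where "a = \<alpha> * s" and "b = \<alpha> / s"
  define a' b' u' v' where "a' = s / r" and "b' = 1 / s / r" and "u' = \<beta> * c / r" and "v' = \<beta> / c / r"
  have ab: "a \<noteq> b" "r * a \<noteq> b" "r * b \<noteq> a"
    using s nz q0 by (auto simp: a_def b_def r_def field_simps power2_eq_square)
  have ab': "a' \<noteq> b'" "1 / r * a' \<noteq> b'" "1 / r * b' \<noteq> a'"
    using s nz q0 by (auto simp: a'_def b'_def r_def field_simps power2_eq_square)
  define dp dm ep em where "dp = asc_diff r a b t (1 / t) m" and "dm = asc_diff r b a t (1 / t) m"
    and "ep = asc_diff (1 / r) a' b' u' v' n" and "em = asc_diff (1 / r) b' a' u' v' n"
  have G: "asc r a b t (1 / t) = G s" by (simp add: a_def b_def G_def)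
  have V: "asc (1 / r) a' b' u' v' n = V s n" for n
    unfolding a'_def b'_def u'_def v'_def V_def by (rule asc_inverse_base[OF r])

  define Dp where "Dp = (s - 1 / s) * (q * s - 1 / (q * s))"
  define Dm where "Dm = (s - 1 / s) * (s / q - q / s)"
  define N1p where "N1p = t + 1 / t - \<alpha> * s - 1 / (\<alpha> * s)"
  define N2p where "N2p = \<beta> * s + 1 / (\<beta> * s) - c - 1 / c"
  define N1m where "N1m = t + 1 / t - s / \<alpha> - \<alpha> / s"
  define N2m where "N2m = s / \<beta> + \<beta> / s - c - 1 / c"
  have D0: "Dp \<noteq> 0" "Dm \<noteq> 0" using ne by (simp_all add: Dp_def Dm_def)

  have dp: "dp = - (s * q / \<alpha>) * N1p / Dp * (G (r * s) m - G s m)"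
  proof -
    have "(a - t) * (a - 1 / t) = - (\<alpha> * s) * N1p"
      unfolding a_def N1p_def using nz by (simp add: field_simps)
    moreover have "(a - b) * (r * a - b) = \<alpha>\<^sup>2 * q * Dp"
      unfolding a_def b_def r_def Dp_def using nz q0 by (simp add: field_simps power2_eq_square)
    ultimately have "r * (a - t) * (a - 1 / t) / ((a - b) * (r * a - b)) = - (s * q / \<alpha>) * N1p / Dp"
      using nz q0 D0 by (simp add: mult.assoc r_def power2_eq_square)
    moreover have "asc r (r * a) (b / r) t (1 / t) m = G (r * s) m"
      by (simp add: a_def b_def G_def mult_ac)
    ultimately show ?thesis unfolding dp_def asc_diff_def G by simp
  qed
  have dm: "dm = - (q / (s * \<alpha>)) * N1m / Dm * (G (s / r) m - G s m)"
  proof -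
    have "(b - t) * (b - 1 / t) = - (\<alpha> / s) * N1m"
      unfolding b_def N1m_def using nz by (simp add: field_simps)
    moreover have "(b - a) * (r * b - a) = \<alpha>\<^sup>2 * q * Dm"
      unfolding a_def b_def r_def Dm_def using nz q0 by (simp add: field_simps power2_eq_square)
    ultimately have "r * (b - t) * (b - 1 / t) / ((b - a) * (r * b - a)) = - (q / (s * \<alpha>)) * N1m / Dm"
      using nz q0 D0 by (simp add: mult.assoc r_def power2_eq_square)
    moreover have "asc r (r * b) (a / r) t (1 / t) m = G (s / r) m"
      by (subst asc_swap) (simp add: a_def b_def G_def mult_ac)
    moreover have "asc r b a t (1 / t) m = G s m"
      by (subst asc_swap) (simp add: G)
    ultimately show ?thesis unfolding dm_def asc_diff_def by simp
  qed
  \<comment> \<open>In base 1/r the shift divides b' = 1/(s r) by r, which is the passage from s to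
    r s. So \<open>em\<close> goes with \<open>dp\<close>, and \<open>ep\<close> with
    \<open>dm\<close>.\<close>
  have em: "em = \<beta> / (q * s) * N2p / Dp * (V (r * s) n - V s n)"
  proof -
    have "(b' - u') * (b' - v') = \<beta> / (s * r\<^sup>2) * N2p"
      unfolding b'_def u'_def v'_def N2p_def using nz r by (simp add: field_simps power2_eq_square)
    moreover have "(b' - a') * (1 / r * b' - a') = Dp / (r\<^sup>2 * q)"
      unfolding a'_def b'_def r_def Dp_def using nz q0 by (simp add: field_simps power2_eq_square)
    ultimately have "1 / r * (b' - u') * (b' - v') / ((b' - a') * (1 / r * b' - a')) = \<beta> / (q * s) * N2p / Dp"
      using nz q0 D0 by (simp add: mult.assoc r_def power2_eq_square)
    moreover have "asc (1 / r) (1 / r * b') (a' / (1 / r)) u' v' n = V (r * s) n"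
    proof -
      have "asc (1 / r) (1 / r * b') (a' / (1 / r)) u' v' n = asc (1 / r) (r * s / r) (1 / (r * s) / r) u' v' n"
        by (subst asc_swap) (use r in \<open>simp add: a'_def b'_def mult_ac\<close>)
      also have "\<dots> = V (r * s) n" unfolding u'_def v'_def V_def by (rule asc_inverse_base[OF r])
      finally show ?thesis .
    qed
    moreover have "asc (1 / r) b' a' u' v' n = V s n"
      by (subst asc_swap) (rule V)
    ultimately show ?thesis unfolding em_def asc_diff_def by simp
  qed
  have ep: "ep = \<beta> * s / q * N2m / Dm * (V (s / r) n - V s n)"
  proof -
    have "(a' - u') * (a' - v') = \<beta> * s / r\<^sup>2 * N2m"
      unfolding a'_def u'_def v'_def N2m_def using nz r by (simp add: field_simps power2_eq_square)
    moreover have "(a' - b') * (1 / r * a' - b') = Dm / (r\<^sup>2 * q)"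
      unfolding a'_def b'_def r_def Dm_def using nz q0 by (simp add: field_simps power2_eq_square)
    ultimately have "1 / r * (a' - u') * (a' - v') / ((a' - b') * (1 / r * a' - b')) = \<beta> * s / q * N2m / Dm"
      using nz q0 D0 by (simp add: mult.assoc r_def power2_eq_square)
    moreover have "asc (1 / r) (1 / r * a') (b' / (1 / r)) u' v' n = V (s / r) n"
    proof -
      have "asc (1 / r) (1 / r * a') (b' / (1 / r)) u' v' n = asc (1 / r) (s / r / r) (1 / (s / r) / r) u' v' n"
        using r by (simp add: a'_def b'_def)
      also have "\<dots> = V (s / r) n" unfolding u'_def v'_def V_def by (rule asc_inverse_base[OF r])
      finally show ?thesis .
    qed
    ultimately show ?thesis unfolding ep_def asc_diff_def V by simp
  qed

  have "- (q / \<beta>) * asc_low r a b t (1 / t) m * ((1 - (1 / r) ^ Suc n) * V s (Suc n))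
      - q ^ 3 / \<beta> * ((1 - r ^ Suc m) * G s (Suc m)) * asc_low (1 / r) a' b' u' v' n
      - (\<alpha> / q * (r ^ m - 1) * (\<beta> - (1 / r) ^ n / \<beta>) +
         q / \<beta> * (1 - (1 / r) ^ n) * (\<alpha> * r ^ m - 1 / \<alpha>)) * (G s m * V s n) =
    - (\<alpha> / \<beta>) * Dp * dp * em - \<alpha> / (s * q) * N2p * dp * V s n + q * s / \<beta> * N1p * G s m * em
    - (\<alpha> / \<beta>) * Dm * dm * ep - \<alpha> * s / q * N2m * dm * V s n + q / (s * \<beta>) * N1m * G s m * ep"
    unfolding Dp_def Dm_def N1p_def N2p_def N1m_def N2m_def
  proof (rule bond_algebra[OF q0 nz(1-5)])
    have *: "b * dp + a * dm = - asc_low r a b t (1 / t) m" and **: "dp + dm = (r ^ m - 1) * G s m"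
      using asc_diff_sums[OF r ab, of t "1 / t" m] unfolding dp_def dm_def G by auto
    show "asc_low r a b t (1 / t) m = - (\<alpha> / s * dp + \<alpha> * s * dm)"
      using * unfolding a_def b_def by linarith
    show "(r ^ m - 1) * G s m = dp + dm" using ** by simp
    show "(1 - r ^ Suc m) * G s (Suc m) =
        (t + 1 / t - \<alpha> * s - \<alpha> / s) * G s m - \<alpha> * s * dp - \<alpha> / s * dm"
      using asc_raise[OF r ab, of m t "1 / t"] unfolding G dp_def dm_def unfolding a_def b_def .
    have *: "b' * ep + a' * em = - asc_low (1 / r) a' b' u' v' n" and **: "ep + em = ((1 / r) ^ n - 1) * V s n"
      using asc_diff_sums[OF r' ab', of u' v' n] unfolding ep_def em_def V by auto
    show "asc_low (1 / r) a' b' u' v' n = - (1 / (s * q\<^sup>2) * ep + s / q\<^sup>2 * em)"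
      using * unfolding a'_def b'_def r_def by simp
    show "((1 / r) ^ n - 1) * V s n = ep + em" using ** by simp
    show "(1 - (1 / r) ^ Suc n) * V s (Suc n) =
       (\<beta> * c / q\<^sup>2 + \<beta> / (c * q\<^sup>2) - s / q\<^sup>2 - 1 / (s * q\<^sup>2)) * V s n - s / q\<^sup>2 * ep - 1 / (s * q\<^sup>2) * em"
      using asc_raise[OF r' ab', of n u' v'] unfolding V ep_def em_def
      unfolding a'_def b'_def u'_def v'_def by (simp add: r_def)
  qed
  also have "\<dots> = N1p * N2p / Dp * (G (r * s) m * V (r * s) n - G s m * V s n) +
      N1m * N2m / Dm * (G (s / r) m * V (s / r) n - G s m * V s n)"
  proof -
    \<comment> \<open>A joint difference is a product of differences plus two single differences,
      which are the three terms present for each direction.\<close>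
    have split: "k * (U * W - g * v) = k * (U - g) * (W - v) + k * (U - g) * v + k * g * (W - v)"
      for k U W g v :: real by (simp add: algebra_simps)
    show ?thesis unfolding split unfolding dp dm ep em using nz q0 D0 by (simp add: mult_ac)
  qed
  finally show ?thesis
    unfolding a_def b_def a'_def b'_def u'_def v'_def Dp_def Dm_def N1p_def N2p_def N1m_def N2m_def .
qed

section \<open>The two-site duality function and the jump rates\<close>

definition two_site :: "real \<Rightarrow> real \<Rightarrow> real \<Rightarrow> real \<Rightarrow> nat \<Rightarrow> nat \<Rightarrow> nat \<Rightarrow> nat \<Rightarrow> real" where
  "two_site q k1 k2 \<rho> n1 n2 x1 x2 =
     q powr (- (1 / 2) * (real n1 * k1 + real n2 * (k2 + 2 * k1))) *
     (p_A q n1 x1 (\<rho> + (2 * real x2 + k2)) k1 * p_A q n2 x2 \<rho> k2)"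

text \<open>Collects what is independent of \<open>x1\<close>, \<open>x2\<close> and \<rho>, so that
  the dynamic process acts on the \<open>asc\<close> factors alone.\<close>

definition two_site_weight :: "real \<Rightarrow> real \<Rightarrow> real \<Rightarrow> nat \<Rightarrow> nat \<Rightarrow> real" where
  "two_site_weight q k1 k2 n1 n2 =
     q powr ((real n1 + real n2) * (1 / 2 - k1) - real n2 * k2) * (asc_weight q k1 n1 * asc_weight q k2 n2)"

lemma two_site_eq_asc:
  assumes q: "q > 0" "q \<noteq> 1" and k: "k1 > 0" "k2 > 0"
    and s: "s = q powr (\<rho> + 2 * real x2 + k2)" and t: "t = q powr (\<rho> + 2 * real x2 + k2 + 2 * real x1 + k1)"
  shows "two_site q k1 k2 \<rho> n1 n2 x1 x2 = two_site_weight q k1 k2 n1 n2 *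
    (asc (q\<^sup>2) (q powr k1 * s) (q powr k1 / s) t (1 / t) n1 *
     asc (q\<^sup>2) (q powr k2 * q powr \<rho>) (q powr k2 / q powr \<rho>) s (1 / s) n2)"
proof -
  have inv: "1 / q powr a = q powr (- a)" for a by (simp add: powr_minus divide_inverse)
  have "p_A q n1 x1 (\<rho> + (2 * real x2 + k2)) k1 = q powr (- (real n1 * (k1 - 1) / 2)) * asc_weight q k1 n1 *
    asc (q\<^sup>2) (q powr k1 * s) (q powr k1 / s) t (1 / t) n1"
    unfolding p_A_eq_asc[OF q k(1)] s t inv by (simp only: powr_add[symmetric] powr_diff[symmetric] add_ac)
  moreover have "p_A q n2 x2 \<rho> k2 = q powr (- (real n2 * (k2 - 1) / 2)) * asc_weight q k2 n2 *
    asc (q\<^sup>2) (q powr k2 * q powr \<rho>) (q powr k2 / q powr \<rho>) s (1 / s) n2"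
    unfolding p_A_eq_asc[OF q k(2)] s inv by (simp only: powr_add[symmetric] powr_diff[symmetric] add_ac)
  moreover have "q powr ((real n1 + real n2) * (1 / 2 - k1) - real n2 * k2) =
     q powr (- (1 / 2) * (real n1 * k1 + real n2 * (k2 + 2 * k1))) * q powr (- (real n1 * (k1 - 1) / 2)) * q powr (- (real n2 * (k2 - 1) / 2))"
    unfolding powr_add[symmetric] by (rule arg_cong[of _ _ "(powr) q"]) (simp add: field_simps)
  ultimately show ?thesis
    by (simp add: two_site_def two_site_weight_def mult_ac)
qed

lemma asc_weight_Suc:
  assumes "q > 0" "q \<noteq> 1" "k > 0"
  shows "asc_weight q k n * q_num q (real (Suc n)) = asc_weight q k (Suc n) * q_num q (real n + k)"
  using assms by (simp add: asc_weight_def q_num_eq_0_iff add.commute)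

lemma q_num_0 [simp]: "q_num q 0 = 0"
  by (simp add: q_num_def)

text \<open>Serves to recognize the numerators of \<open>asc_bond\<close> in the dynamic rates: each
  is a product of two q-numbers.\<close>

lemma q_num_mult:
  assumes "q > 0" "q \<noteq> 1"
  shows "(q - inverse q)\<^sup>2 * (q_num q a * q_num q b) =
    q powr (a + b) + 1 / q powr (a + b) - q powr (a - b) - 1 / q powr (a - b)"
proof -
  have "(q - inverse q)\<^sup>2 * (q_num q a * q_num q b) =
     (q powr a - q powr - a) * (q powr b - q powr - b)"
    using q_minus_inverse_neq_0[OF assms] by (simp add: q_num_def power2_eq_square)
  also have "\<dots> = q powr (a + b) + 1 / q powr (a + b) - q powr (a - b) - 1 / q powr (a - b)"
    using assms by (simp add: powr_add powr_diff powr_minus field_simps)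
  finally show ?thesis .
qed

definition two_site_right :: "real \<Rightarrow> real \<Rightarrow> real \<Rightarrow> nat \<Rightarrow> nat \<Rightarrow> real" where
  "two_site_right q k1 k2 n1 n2 =
     q powr (real n1 + k1 - real n2 - 1) * q_num q (real n1) * q_num q (real n2 + k2)"

definition two_site_left :: "real \<Rightarrow> real \<Rightarrow> real \<Rightarrow> nat \<Rightarrow> nat \<Rightarrow> real" where
  "two_site_left q k1 k2 n1 n2 =
     q powr (- (real n2 + k2 - real n1 - 1)) * q_num q (real n2) * q_num q (real n1 + k1)"

lemma inverse_square_powr: "q > 0 \<Longrightarrow> (1 / q\<^sup>2) ^ n = q powr (- (2 * real n))" for q :: real
  unfolding power_divide square_powr by (simp add: powr_minus divide_inverse)

text \<open>\<open>asc_weight_Suc\<close> trades the factors [n1] and [n2 + k2] of the rate for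
  [n1 - 1 + k1] and [n2 + 1], which belong to lowering on the left and raising on the right. The
  jump thus splits into a product of one-site operators.\<close>

lemma two_site_right_mult_weight:
  assumes q: "q > 0" "q \<noteq> 1" and k: "k1 > 0" "k2 > 0"
  shows "(q - inverse q)\<^sup>2 * two_site_right q k1 k2 n1 n2 *
      (two_site_weight q k1 k2 (n1 - 1) (Suc n2) * (asc (q\<^sup>2) a b u v (n1 - 1) * g)) =
    two_site_weight q k1 k2 n1 n2 * (- (q / q powr k2) * ((case n1 of 0 \<Rightarrow> 0 | Suc m \<Rightarrow> (1 - (q powr k1)\<^sup>2 * (q\<^sup>2) ^ m) * asc (q\<^sup>2) a b u v m)
       * ((1 - (1 / q\<^sup>2) ^ Suc n2) * g)))"
proof (cases n1)
  case 0
  then show ?thesis by (simp add: two_site_right_def)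
next
  case (Suc m)
  define \<kappa> where "\<kappa> = q - inverse q"
  have \<kappa>: "\<kappa> \<noteq> 0" unfolding \<kappa>_def by (rule q_minus_inverse_neq_0[OF q])
  define E where "E = q powr ((real n1 + real n2) * (1 / 2 - k1) - real n2 * k2)"
  define w where "w = asc_weight q k1 n1 * asc_weight q k2 n2"
  have E: "q powr ((real m + real (Suc n2)) * (1 / 2 - k1) - real (Suc n2) * k2) = E / q powr k2"
    unfolding E_def powr_diff[symmetric] Suc by (rule arg_cong[of _ _ "(powr) q"]) (simp add: field_simps)
  have w: "q_num q (real n1) * q_num q (real n2 + k2) * (asc_weight q k1 m * asc_weight q k2 (Suc n2)) =
      w * (q_num q (real m + k1) * q_num q (real (Suc n2)))"
    using asc_weight_Suc[OF q k(1), of m] asc_weight_Suc[OF q k(2), of n2] unfolding w_def Suc by algebra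
  have "\<kappa> * q_num q (real m + k1) = q powr (real m + k1) - q powr - (real m + k1)"
    using \<kappa> by (simp add: q_num_def \<kappa>_def)
  also have "\<dots> = - (1 - (q powr k1)\<^sup>2 * (q\<^sup>2) ^ m) * q powr - (real m + k1)"
    unfolding square_powr[OF q(1)] by (simp add: algebra_simps power2_eq_square powr_add[symmetric])
  finally have 1: "\<kappa> * q_num q (real m + k1) = - (1 - (q powr k1)\<^sup>2 * (q\<^sup>2) ^ m) * q powr - (real m + k1)" .
  have "\<kappa> * q_num q (real (Suc n2)) = q powr (real (Suc n2)) - q powr - (real (Suc n2))"
    using \<kappa> by (simp add: q_num_def \<kappa>_def)
  also have "\<dots> = (1 - (1 / q\<^sup>2) ^ Suc n2) * q powr real (Suc n2)"
  proof -
    show ?thesis unfolding inverse_square_powr[OF q(1)]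
      by (simp add: left_diff_distrib powr_add[symmetric] del: of_nat_Suc)
  qed
  finally have 2: "\<kappa> * q_num q (real (Suc n2)) = (1 - (1 / q\<^sup>2) ^ Suc n2) * q powr real (Suc n2)" .
  have 3: "q powr (real n1 + k1 - real n2 - 1) * q powr - (real m + k1) * q powr real (Suc n2) = q"
    using q unfolding powr_add[symmetric] Suc by simp
  have "\<kappa>\<^sup>2 * two_site_right q k1 k2 n1 n2 * (two_site_weight q k1 k2 m (Suc n2) * (asc (q\<^sup>2) a b u v m * g)) =
     q powr (real n1 + k1 - real n2 - 1) * (E / q powr k2) *
     (\<kappa>\<^sup>2 * (q_num q (real n1) * q_num q (real n2 + k2) * (asc_weight q k1 m * asc_weight q k2 (Suc n2)))) * (asc (q\<^sup>2) a b u v m * g)"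
    unfolding two_site_right_def two_site_weight_def E by (simp only: mult_ac)
  also have "\<dots> = q powr (real n1 + k1 - real n2 - 1) * (E / q powr k2) * w *
     ((\<kappa> * q_num q (real m + k1)) * (\<kappa> * q_num q (real (Suc n2)))) * (asc (q\<^sup>2) a b u v m * g)"
    unfolding w power2_eq_square by (simp only: mult_ac)
  also have "\<dots> = (q powr (real n1 + k1 - real n2 - 1) * q powr - (real m + k1) * q powr real (Suc n2)) * (E / q powr k2) * w *
     (- (1 - (q powr k1)\<^sup>2 * (q\<^sup>2) ^ m) * (1 - (1 / q\<^sup>2) ^ Suc n2)) * (asc (q\<^sup>2) a b u v m * g)"
    unfolding 1 2 by (simp only: mult_ac)
  also have "\<dots> = (E * w) * (- (q / q powr k2) * ((1 - (q powr k1)\<^sup>2 * (q\<^sup>2) ^ m) * asc (q\<^sup>2) a b u v m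
       * ((1 - (1 / q\<^sup>2) ^ Suc n2) * g)))"
  proof -
    have "x * (E / y) * w * (- A * B) * (C * g) = (E * w) * (- (x / y) * (A * C * (B * g)))" for x y A B C :: real
      by simp
    then show ?thesis unfolding 3 .
  qed
  finally show ?thesis
    unfolding \<kappa>_def two_site_weight_def E_def w_def by (simp add: Suc del: power_Suc of_nat_Suc)
qed

text \<open>The same splitting for the opposite jump. The division by q^4 anticipates
  \<open>asc_low\<close> in base 1/r, whose four parameters each carry a factor 1/r.\<close>

lemma two_site_left_mult_weight:
  assumes q: "q > 0" "q \<noteq> 1" and k: "k1 > 0" "k2 > 0"
  shows "(q - inverse q)\<^sup>2 * two_site_left q k1 k2 n1 n2 *
      (two_site_weight q k1 k2 (Suc n1) (n2 - 1) * (g * asc (q\<^sup>2) a b u v (n2 - 1))) =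
    two_site_weight q k1 k2 n1 n2 * (- (q ^ 3 / q powr k2) * (((1 - (q\<^sup>2) ^ Suc n1) * g) *
       (case n2 of 0 \<Rightarrow> 0 | Suc m \<Rightarrow> ((q powr k2)\<^sup>2 - (1 / q\<^sup>2) ^ m) / q ^ 4 * asc (q\<^sup>2) a b u v m)))"
proof (cases n2)
  case 0
  then show ?thesis by (simp add: two_site_left_def)
next
  case (Suc m)
  define \<kappa> where "\<kappa> = q - inverse q"
  have \<kappa>: "\<kappa> \<noteq> 0" unfolding \<kappa>_def by (rule q_minus_inverse_neq_0[OF q])
  define E where "E = q powr ((real n1 + real n2) * (1 / 2 - k1) - real n2 * k2)"
  define w where "w = asc_weight q k1 n1 * asc_weight q k2 n2"
  have E: "q powr ((real (Suc n1) + real m) * (1 / 2 - k1) - real m * k2) = E * q powr k2"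
    unfolding E_def powr_add[symmetric] Suc by (rule arg_cong[of _ _ "(powr) q"]) (simp add: field_simps)
  have w: "q_num q (real n2) * q_num q (real n1 + k1) * (asc_weight q k1 (Suc n1) * asc_weight q k2 m) =
      w * (q_num q (real (Suc n1)) * q_num q (real m + k2))"
    using asc_weight_Suc[OF q k(1), of n1] asc_weight_Suc[OF q k(2), of m] unfolding w_def Suc by algebra
  have "\<kappa> * q_num q (real (Suc n1)) = q powr (real (Suc n1)) - q powr - (real (Suc n1))"
    using \<kappa> by (simp add: q_num_def \<kappa>_def)
  also have "\<dots> = - (1 - (q\<^sup>2) ^ Suc n1) * q powr - real (Suc n1)"
    unfolding square_powr[OF q(1)] by (simp add: left_diff_distrib powr_add[symmetric] del: of_nat_Suc)
  finally have 1: "\<kappa> * q_num q (real (Suc n1)) = - (1 - (q\<^sup>2) ^ Suc n1) * q powr - real (Suc n1)" .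
  have "\<kappa> * q_num q (real m + k2) = q powr (real m + k2) - q powr - (real m + k2)"
    using \<kappa> by (simp add: q_num_def \<kappa>_def)
  also have "\<dots> = ((q powr k2)\<^sup>2 - (1 / q\<^sup>2) ^ m) * q powr (real m - k2)"
  proof -
    show ?thesis unfolding inverse_square_powr[OF q(1)]
      by (simp add: left_diff_distrib power2_eq_square powr_add[symmetric] add.commute)
  qed
  finally have 2: "\<kappa> * q_num q (real m + k2) = ((q powr k2)\<^sup>2 - (1 / q\<^sup>2) ^ m) * q powr (real m - k2)" .
  have 3: "q powr (- (real n2 + k2 - real n1 - 1)) * q powr - real (Suc n1) * q powr (real m - k2) * q powr k2
      = q ^ 3 / q powr k2 / q ^ 4"
  proof -
    have "q ^ 3 / q powr k2 / q ^ 4 = q powr (- 1 - k2)"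
      using q by (simp add: powr_diff powr_minus field_simps eval_nat_numeral)
    then show ?thesis unfolding powr_add[symmetric] Suc by (simp add: algebra_simps)
  qed
  have "\<kappa>\<^sup>2 * two_site_left q k1 k2 n1 n2 * (two_site_weight q k1 k2 (Suc n1) m * (g * asc (q\<^sup>2) a b u v m)) =
     q powr (- (real n2 + k2 - real n1 - 1)) * (E * q powr k2) *
     (\<kappa>\<^sup>2 * (q_num q (real n2) * q_num q (real n1 + k1) * (asc_weight q k1 (Suc n1) * asc_weight q k2 m))) * (g * asc (q\<^sup>2) a b u v m)"
    unfolding two_site_left_def two_site_weight_def E by (simp only: mult_ac)
  also have "\<dots> = q powr (- (real n2 + k2 - real n1 - 1)) * (E * q powr k2) * w *
     ((\<kappa> * q_num q (real (Suc n1))) * (\<kappa> * q_num q (real m + k2))) * (g * asc (q\<^sup>2) a b u v m)"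
    unfolding w power2_eq_square by (simp only: mult_ac)
  also have "\<dots> = (q powr (- (real n2 + k2 - real n1 - 1)) * q powr - real (Suc n1) * q powr (real m - k2) * q powr k2) * E * w *
     (- (1 - (q\<^sup>2) ^ Suc n1) * ((q powr k2)\<^sup>2 - (1 / q\<^sup>2) ^ m)) * (g * asc (q\<^sup>2) a b u v m)"
    unfolding 1 2 by (simp only: mult_ac)
  also have "\<dots> = (E * w) * (- (q ^ 3 / q powr k2) * (((1 - (q\<^sup>2) ^ Suc n1) * g) *
        (((q powr k2)\<^sup>2 - (1 / q\<^sup>2) ^ m) / q ^ 4 * asc (q\<^sup>2) a b u v m)))"
  proof -
    have "x / y * E * w * (- A * B) * (g * C) = (E * w) * (- x * ((A * g) * (B / y * C)))" for x y A B C :: real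
      by simp
    then show ?thesis unfolding 3 .
  qed
  finally show ?thesis
    unfolding \<kappa>_def two_site_weight_def E_def w_def by (simp add: Suc del: power_Suc of_nat_Suc)
qed

text \<open>Brings the diagonal term of the bond into the shape required by
  \<open>bond_algebra\<close>, with X = q^(2 n1) and Y = q^(-2 n2).\<close>

lemma two_site_rates_sum:
  fixes q k1 k2 :: real
  assumes q: "q > 0" "q \<noteq> 1"
  defines "\<alpha> \<equiv> q powr k1" and "\<beta> \<equiv> q powr k2"
  shows "(q - inverse q)\<^sup>2 * (two_site_right q k1 k2 n1 n2 + two_site_left q k1 k2 n1 n2) =
    \<alpha> / q * ((q\<^sup>2) ^ n1 - 1) * (\<beta> - (1 / q\<^sup>2) ^ n2 / \<beta>) +
         q / \<beta> * (1 - (1 / q\<^sup>2) ^ n2) * (\<alpha> * (q\<^sup>2) ^ n1 - 1 / \<alpha>)"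
proof -
  define a b where "a = q powr real n1" and "b = q powr real n2"
  have nz: "q \<noteq> 0" "\<alpha> \<noteq> 0" "\<beta> \<noteq> 0" "a \<noteq> 0" "b \<noteq> 0"
    using q by (simp_all add: \<alpha>_def \<beta>_def a_def b_def)
  have n: "(q\<^sup>2) ^ n1 = a\<^sup>2" "(1 / q\<^sup>2) ^ n2 = 1 / b\<^sup>2"
    unfolding power_divide square_powr[OF q(1)] a_def b_def
    by (simp_all add: power2_eq_square powr_add[symmetric])
  have k: "q - inverse q \<noteq> 0" by (rule q_minus_inverse_neq_0[OF q])
  have "(q - inverse q)\<^sup>2 * two_site_right q k1 k2 n1 n2 =
      (a * \<alpha> / b / q) * ((q - inverse q) * q_num q (real n1)) * ((q - inverse q) * q_num q (real n2 + k2))"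
    using q by (simp add: two_site_right_def a_def b_def \<alpha>_def powr_add powr_diff power2_eq_square)
  also have "\<dots> = (a * \<alpha> / b / q) * (a - 1 / a) * (b * \<beta> - 1 / (b * \<beta>))"
    using k by (simp add: q_num_def a_def b_def \<beta>_def powr_add powr_minus powr_diff divide_inverse)
  finally have 1: "(q - inverse q)\<^sup>2 * two_site_right q k1 k2 n1 n2 = (a * \<alpha> / b / q) * (a - 1 / a) * (b * \<beta> - 1 / (b * \<beta>))" .
  have "(q - inverse q)\<^sup>2 * two_site_left q k1 k2 n1 n2 =
      (a * q / (b * \<beta>)) * ((q - inverse q) * q_num q (real n2)) * ((q - inverse q) * q_num q (real n1 + k1))"
    using q by (simp add: two_site_left_def a_def b_def \<beta>_def powr_add powr_diff power2_eq_square)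
  also have "\<dots> = (a * q / (b * \<beta>)) * (b - 1 / b) * (a * \<alpha> - 1 / (a * \<alpha>))"
    using k by (simp add: q_num_def a_def b_def \<alpha>_def powr_add powr_minus powr_diff divide_inverse)
  finally have 2: "(q - inverse q)\<^sup>2 * two_site_left q k1 k2 n1 n2 = (a * q / (b * \<beta>)) * (b - 1 / b) * (a * \<alpha> - 1 / (a * \<alpha>))" .
  show ?thesis unfolding distrib_left 1 2 n using nz by (simp add: field_simps power2_eq_square)
qed

definition two_site_dyn_right :: "real \<Rightarrow> real \<Rightarrow> real \<Rightarrow> real \<Rightarrow> nat \<Rightarrow> nat \<Rightarrow> real" where
  "two_site_dyn_right q k1 k2 \<rho> x1 x2 =
     (let h = \<rho> + (2 * real x2 + k2) in
      if x1 = 0 then 0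
      else q_num q (real x1) * q_num q (real x2 + k2) *
           (q_num q (h + (2 * real x1 + k1) - real x1) / q_num q (h + 1)) *
           (if x2 = 0 then 1 else q_num q (h - real x2) / q_num q h))"

definition two_site_dyn_left :: "real \<Rightarrow> real \<Rightarrow> real \<Rightarrow> real \<Rightarrow> nat \<Rightarrow> nat \<Rightarrow> real" where
  "two_site_dyn_left q k1 k2 \<rho> x1 x2 =
     (let h = \<rho> + (2 * real x2 + k2) in
      if x2 = 0 then 0
      else q_num q (real x2) * q_num q (real x1 + k1) *
           ((q_num q (h + real x1) * q_num q (\<rho> + real x2)) / (q_num q h * q_num q (h - 1))))"

lemma two_site_dyn_rates:
  assumes q: "q > 0" "q \<noteq> 1"
    and h: "\<rho> + 2 * real x2 + k2 \<noteq> 0" "\<rho> + 2 * real x2 + k2 \<noteq> 1" "\<rho> + 2 * real x2 + k2 \<noteq> - 1"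
    and s: "s = q powr (\<rho> + 2 * real x2 + k2)" and t: "t = q powr (\<rho> + 2 * real x2 + k2 + 2 * real x1 + k1)"
    and c: "c = q powr \<rho>" and \<alpha>: "\<alpha> = q powr k1" and \<beta>: "\<beta> = q powr k2"
  shows "(q - inverse q)\<^sup>2 * two_site_dyn_right q k1 k2 \<rho> x1 x2 =
      (t + 1 / t - \<alpha> * s - 1 / (\<alpha> * s)) * (\<beta> * s + 1 / (\<beta> * s) - c - 1 / c)
      / ((s - 1 / s) * (q * s - 1 / (q * s)))" (is ?R)
    and "(q - inverse q)\<^sup>2 * two_site_dyn_left q k1 k2 \<rho> x1 x2 =
      (t + 1 / t - s / \<alpha> - \<alpha> / s) * (s / \<beta> + \<beta> / s - c - 1 / c)
      / ((s - 1 / s) * (s / q - q / s))" (is ?L)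
proof -
  define \<kappa> where "\<kappa> = q - inverse q"
  have \<kappa>: "\<kappa> \<noteq> 0" unfolding \<kappa>_def by (rule q_minus_inverse_neq_0[OF q])
  define h where "h = \<rho> + 2 * real x2 + k2"
  have h0: "q_num q h \<noteq> 0" using assms(3) by (simp add: q_num_eq_0_iff[OF q] h_def)
  have hs: "\<kappa> * q_num q h = s - 1 / s"
    using \<kappa> unfolding s h_def[symmetric] by (simp add: q_num_def \<kappa>_def powr_minus inverse_eq_divide)
  have hs1: "\<kappa> * q_num q (h + 1) = q * s - 1 / (q * s)" "\<kappa> * q_num q (h - 1) = s / q - q / s"
  proof -
    have "q powr (h + 1) = q * s" "q powr - (h + 1) = 1 / (q * s)"
      "q powr (h - 1) = s / q" "q powr - (h - 1) = q / s"
      using q by (simp_all add: s h_def[symmetric] powr_add powr_diff powr_minus divide_inverse)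
    then show "\<kappa> * q_num q (h + 1) = q * s - 1 / (q * s)" "\<kappa> * q_num q (h - 1) = s / q - q / s"
      using \<kappa> by (simp_all add: q_num_def \<kappa>_def)
  qed
  have mult: "\<kappa>\<^sup>2 * (q_num q a * q_num q b) = A + 1 / A - B - 1 / B"
    if "q powr (a + b) = A" "q powr (a - b) = B" for a b A B
    using q_num_mult[OF q, of a b] that unfolding \<kappa>_def by simp
  have N1: "\<kappa>\<^sup>2 * (q_num q (h + (2 * real x1 + k1) - real x1) * q_num q (real x1)) = t + 1 / t - \<alpha> * s - 1 / (\<alpha> * s)"
    by (rule mult) (simp_all add: t s \<alpha> h_def powr_add[symmetric] add_ac)
  have N2: "\<kappa>\<^sup>2 * (q_num q (real x2 + k2) * q_num q (h - real x2)) = \<beta> * s + 1 / (\<beta> * s) - c - 1 / c"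
  proof (subst mult.commute[of "q_num q (real x2 + k2)"], rule mult)
    show "q powr (h - real x2 + (real x2 + k2)) = \<beta> * s"
      by (simp add: s \<beta> h_def powr_add[symmetric] add_ac)
    show "q powr (h - real x2 - (real x2 + k2)) = c"
      by (simp add: c h_def)
  qed
  have M1: "\<kappa>\<^sup>2 * (q_num q (h + real x1) * q_num q (real x1 + k1)) = t + 1 / t - s / \<alpha> - \<alpha> / s"
  proof -
    have "\<kappa>\<^sup>2 * (q_num q (h + real x1) * q_num q (real x1 + k1)) = t + 1 / t - s / \<alpha> - 1 / (s / \<alpha>)"
      by (rule mult) (simp_all add: t s \<alpha> h_def powr_diff[symmetric] algebra_simps)
    then show ?thesis by simp
  qed
  have M2: "\<kappa>\<^sup>2 * (q_num q (\<rho> + real x2) * q_num q (real x2)) = s / \<beta> + \<beta> / s - c - 1 / c"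
  proof -
    have "\<kappa>\<^sup>2 * (q_num q (\<rho> + real x2) * q_num q (real x2)) = s / \<beta> + 1 / (s / \<beta>) - c - 1 / c"
      by (rule mult) (simp_all add: c s \<beta> h_def powr_diff[symmetric] algebra_simps)
    then show ?thesis by simp
  qed
  \<comment> \<open>For \<open>x2 = 0\<close> the quotient [h] / [h] is 1 because the height is
    nonzero, so the convention agrees with the formula.\<close>
  have "two_site_dyn_right q k1 k2 \<rho> x1 x2 =
     (q_num q (h + (2 * real x1 + k1) - real x1) * q_num q (real x1)) * (q_num q (real x2 + k2) * q_num q (h - real x2))
     / (q_num q h * q_num q (h + 1))"
    using h0 by (cases "x2 = 0") (simp_all add: two_site_dyn_right_def Let_def h_def add_ac mult_ac)
  then have "\<kappa>\<^sup>2 * two_site_dyn_right q k1 k2 \<rho> x1 x2 =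
     (\<kappa>\<^sup>2 * (q_num q (h + (2 * real x1 + k1) - real x1) * q_num q (real x1))) * (\<kappa>\<^sup>2 * (q_num q (real x2 + k2) * q_num q (h - real x2)))
     / ((\<kappa> * q_num q h) * (\<kappa> * q_num q (h + 1)))"
    using \<kappa> by (simp add: power2_eq_square)
  then show ?R unfolding N1 N2 hs hs1 unfolding \<kappa>_def .
  have "two_site_dyn_left q k1 k2 \<rho> x1 x2 =
     (q_num q (h + real x1) * q_num q (real x1 + k1)) * (q_num q (\<rho> + real x2) * q_num q (real x2))
     / (q_num q h * q_num q (h - 1))"
    by (simp add: two_site_dyn_left_def Let_def h_def add_ac mult_ac)
  then have "\<kappa>\<^sup>2 * two_site_dyn_left q k1 k2 \<rho> x1 x2 =
     (\<kappa>\<^sup>2 * (q_num q (h + real x1) * q_num q (real x1 + k1))) * (\<kappa>\<^sup>2 * (q_num q (\<rho> + real x2) * q_num q (real x2)))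
     / ((\<kappa> * q_num q h) * (\<kappa> * q_num q (h - 1)))"
    using \<kappa> by (simp add: power2_eq_square)
  then show ?L unfolding M1 M2 hs hs1 unfolding \<kappa>_def .
qed

section \<open>Two-site duality away from the singular heights\<close>

lemma two_site_duality_generic:
  fixes q k1 k2 \<rho> :: real
  assumes q: "q > 0" "q \<noteq> 1" and k: "k1 > 0" "k2 > 0"
    and h: "\<rho> + 2 * real x2 + k2 \<noteq> 0" "\<rho> + 2 * real x2 + k2 \<noteq> 1" "\<rho> + 2 * real x2 + k2 \<noteq> - 1"
  defines "D \<equiv> two_site q k1 k2 \<rho>"
  shows "two_site_right q k1 k2 n1 n2 * (D (n1 - 1) (Suc n2) x1 x2 - D n1 n2 x1 x2)
       + two_site_left q k1 k2 n1 n2 * (D (Suc n1) (n2 - 1) x1 x2 - D n1 n2 x1 x2)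
       = two_site_dyn_right q k1 k2 \<rho> x1 x2 * (D n1 n2 (x1 - 1) (Suc x2) - D n1 n2 x1 x2)
       + two_site_dyn_left q k1 k2 \<rho> x1 x2 * (D n1 n2 (Suc x1) (x2 - 1) - D n1 n2 x1 x2)"
    (is "?lhs = ?rhs")
proof -
  define \<alpha> \<beta> s t c r where "\<alpha> = q powr k1" and "\<beta> = q powr k2" and "s = q powr (\<rho> + 2 * real x2 + k2)"
    and "t = q powr (\<rho> + 2 * real x2 + k2 + 2 * real x1 + k1)" and "c = q powr \<rho>" and "r = q\<^sup>2"
  define \<kappa> where "\<kappa> = (q - inverse q)\<^sup>2"
  have \<kappa>: "\<kappa> \<noteq> 0" unfolding \<kappa>_def using q_minus_inverse_neq_0[OF q] by simp
  have r0: "r \<noteq> 0" using q by (simp add: r_def)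
  have r2: "r = q powr 2" using q by (simp add: r_def)
  define G where "G \<sigma> n = asc r (\<alpha> * \<sigma>) (\<alpha> / \<sigma>) t (1 / t) n" for \<sigma> n
  define V where "V \<sigma> n = asc r (\<beta> * c) (\<beta> / c) \<sigma> (1 / \<sigma>) n" for \<sigma> n
  define W where "W = two_site_weight q k1 k2"
  have D: "D m n x1 x2 = W m n * (G s m * V s n)" for m n
    unfolding D_def W_def G_def V_def \<alpha>_def \<beta>_def c_def r_def
    by (rule two_site_eq_asc[OF q k]) (simp_all add: s_def t_def)
  \<comment> \<open>The jump raises the height between the sites by 2 and keeps the outer ones: s
    becomes r s, while t and c stay. At \<open>x1 = 0\<close> the truncated \<open>x1 - 1\<close>
    would spoil this, but there the rate is 0 (\<open>T4\<close>).\<close>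
  have Dp: "D m n (x1 - 1) (Suc x2) = W m n * (G (r * s) m * V (r * s) n)" if "x1 > 0" for m n
    unfolding D_def W_def G_def V_def \<alpha>_def \<beta>_def c_def r_def[symmetric]
    unfolding r_def
    by (rule two_site_eq_asc[OF q k])
       (use that in \<open>simp_all add: s_def t_def r_def[symmetric] r2 powr_add[symmetric] of_nat_diff algebra_simps\<close>)
  have Dm: "D m n (Suc x1) (x2 - 1) = W m n * (G (s / r) m * V (s / r) n)" if "x2 > 0" for m n
    unfolding D_def W_def G_def V_def \<alpha>_def \<beta>_def c_def r_def[symmetric]
    unfolding r_def
    by (rule two_site_eq_asc[OF q k])
       (use that in \<open>simp_all add: s_def t_def r_def[symmetric] r2 powr_diff[symmetric] of_nat_diff algebra_simps\<close>)
  have s2: "s\<^sup>2 = q powr (2 * (\<rho> + 2 * real x2 + k2))"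
    by (simp add: s_def power2_eq_square powr_add[symmetric] algebra_simps)
  have s_ne: "s\<^sup>2 \<noteq> 1" "q\<^sup>2 * s\<^sup>2 \<noteq> 1" "s\<^sup>2 \<noteq> q\<^sup>2"
  proof -
    show "s\<^sup>2 \<noteq> 1" using h(1) unfolding s2 by (simp add: powr_eq_1_iff_exponent[OF q])
    have "q\<^sup>2 * s\<^sup>2 = q powr (2 * (\<rho> + 2 * real x2 + k2 + 1))"
      unfolding s2 r_def[symmetric] r2 powr_add[symmetric] by (simp add: algebra_simps)
    then show "q\<^sup>2 * s\<^sup>2 \<noteq> 1" using h(3) by (simp add: powr_eq_1_iff_exponent[OF q])
    have "s\<^sup>2 / q\<^sup>2 = q powr (2 * (\<rho> + 2 * real x2 + k2 - 1))"
      unfolding s2 r_def[symmetric] r2 powr_diff[symmetric] by (simp add: algebra_simps)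
    then have "s\<^sup>2 / q\<^sup>2 \<noteq> 1" using h(2) by (simp add: powr_eq_1_iff_exponent[OF q])
    then show "s\<^sup>2 \<noteq> q\<^sup>2" using q by auto
  qed
  have nz: "\<alpha> \<noteq> 0" "\<beta> \<noteq> 0" "s \<noteq> 0" "t \<noteq> 0" "c \<noteq> 0"
    using q by (simp_all add: \<alpha>_def \<beta>_def s_def t_def c_def)
  note rates = two_site_dyn_rates[OF q h s_def t_def c_def \<alpha>_def \<beta>_def]

  \<comment> \<open>\<open>T1\<close> and \<open>T2\<close> write the two ASIP jumps as products of
    a lowering and a raising operator; \<open>T3\<close> is the diagonal part.\<close>
  have "asc_low r (\<alpha> * s) (\<alpha> / s) t (1 / t) n1 = (case n1 of 0 \<Rightarrow> 0 | Suc m \<Rightarrow> (1 - \<alpha>\<^sup>2 * r ^ m) * G s m)"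
    using nz by (simp add: asc_low_def G_def power2_eq_square split: nat.split)
  then have T1: "\<kappa> * two_site_right q k1 k2 n1 n2 * D (n1 - 1) (Suc n2) x1 x2 =
      W n1 n2 * (- (q / \<beta>) * (asc_low r (\<alpha> * s) (\<alpha> / s) t (1 / t) n1 * ((1 - (1 / r) ^ Suc n2) * V s (Suc n2))))"
    unfolding D unfolding \<kappa>_def W_def G_def r_def \<alpha>_def \<beta>_def
    by (simp only: two_site_right_mult_weight[OF q k])
  have "asc_low (1 / r) (s / r) (1 / s / r) (\<beta> * c / r) (\<beta> / c / r) n2 =
      (case n2 of 0 \<Rightarrow> 0 | Suc m \<Rightarrow> (\<beta>\<^sup>2 - (1 / r) ^ m) / q ^ 4 * V s m)"
  proof (cases n2)
    case (Suc m)
    have "r > 0" "r \<noteq> 1" using q by (auto simp: r_def power2_eq_1_iff)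
    then have "asc (1 / r) (s / r) (1 / s / r) (\<beta> * c / r) (\<beta> / c / r) m = V s m"
      unfolding V_def by (rule asc_inverse_base)
    moreover have "\<beta> * c / r * (\<beta> / c / r) - s / r * (1 / s / r) * (1 / r) ^ m = (\<beta>\<^sup>2 - (1 / r) ^ m) / q ^ 4"
      using nz r0 unfolding r_def by (simp add: diff_divide_distrib power2_eq_square eval_nat_numeral)
    ultimately show ?thesis unfolding Suc asc_low_simps by simp
  qed simp
  then have T2: "\<kappa> * two_site_left q k1 k2 n1 n2 * D (Suc n1) (n2 - 1) x1 x2 =
      W n1 n2 * (- (q ^ 3 / \<beta>) * (((1 - r ^ Suc n1) * G s (Suc n1)) *
         asc_low (1 / r) (s / r) (1 / s / r) (\<beta> * c / r) (\<beta> / c / r) n2))"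
    unfolding D unfolding \<kappa>_def W_def V_def r_def \<alpha>_def \<beta>_def
    by (simp only: two_site_left_mult_weight[OF q k])
  have T3: "\<kappa> * (two_site_right q k1 k2 n1 n2 + two_site_left q k1 k2 n1 n2) =
    \<alpha> / q * (r ^ n1 - 1) * (\<beta> - (1 / r) ^ n2 / \<beta>) + q / \<beta> * (1 - (1 / r) ^ n2) * (\<alpha> * r ^ n1 - 1 / \<alpha>)"
    unfolding \<kappa>_def r_def \<alpha>_def \<beta>_def by (rule two_site_rates_sum[OF q])
  have T4: "two_site_dyn_right q k1 k2 \<rho> x1 x2 * (D n1 n2 (x1 - 1) (Suc x2) - D n1 n2 x1 x2) =
     two_site_dyn_right q k1 k2 \<rho> x1 x2 * (W n1 n2 * (G (r * s) n1 * V (r * s) n2 - G s n1 * V s n2))"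
  proof (cases "x1 = 0")
    case False
    then have "x1 > 0" by simp
    then show ?thesis by (simp only: D Dp right_diff_distrib)
  qed (simp add: two_site_dyn_right_def)
  have T5: "two_site_dyn_left q k1 k2 \<rho> x1 x2 * (D n1 n2 (Suc x1) (x2 - 1) - D n1 n2 x1 x2) =
     two_site_dyn_left q k1 k2 \<rho> x1 x2 * (W n1 n2 * (G (s / r) n1 * V (s / r) n2 - G s n1 * V s n2))"
  proof (cases "x2 = 0")
    case False
    then have "x2 > 0" by simp
    then show ?thesis by (simp only: D Dm right_diff_distrib)
  qed (simp add: two_site_dyn_left_def)
  have "\<kappa> * ?lhs = \<kappa> * two_site_right q k1 k2 n1 n2 * D (n1 - 1) (Suc n2) x1 x2
     + \<kappa> * two_site_left q k1 k2 n1 n2 * D (Suc n1) (n2 - 1) x1 x2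
     - \<kappa> * (two_site_right q k1 k2 n1 n2 + two_site_left q k1 k2 n1 n2) * D n1 n2 x1 x2"
    by (simp add: algebra_simps)
  also have "\<dots> = W n1 n2 * (- (q / \<beta>) * asc_low r (\<alpha> * s) (\<alpha> / s) t (1 / t) n1 * ((1 - (1 / r) ^ Suc n2) * V s (Suc n2))
      - q ^ 3 / \<beta> * ((1 - r ^ Suc n1) * G s (Suc n1)) *
          asc_low (1 / r) (s / r) (1 / s / r) (\<beta> * c / r) (\<beta> / c / r) n2
      - (\<alpha> / q * (r ^ n1 - 1) * (\<beta> - (1 / r) ^ n2 / \<beta>) +
         q / \<beta> * (1 - (1 / r) ^ n2) * (\<alpha> * r ^ n1 - 1 / \<alpha>)) * (G s n1 * V s n2))"
  proof -
    have "w * (- a * (l * m)) + w * (- b * (n * p)) - d * (w * x) = w * (- a * l * m - b * n * p - d * x)"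
      for w a l m b n p d x :: real by (simp add: algebra_simps)
    then show ?thesis unfolding T1 T2 T3 unfolding D .
  qed
  also have "\<dots> = W n1 n2 * (\<kappa> * two_site_dyn_right q k1 k2 \<rho> x1 x2 * (G (r * s) n1 * V (r * s) n2 - G s n1 * V s n2)
     + \<kappa> * two_site_dyn_left q k1 k2 \<rho> x1 x2 * (G (s / r) n1 * V (s / r) n2 - G s n1 * V s n2))"
    unfolding \<kappa>_def rates unfolding G_def V_def r_def
    by (rule arg_cong[OF asc_bond[OF q nz s_ne]])
  also have "\<dots> = \<kappa> * ?rhs"
    unfolding T4 T5 by (simp add: algebra_simps)
  finally show ?thesis using \<kappa> by simp
qed

section \<open>Continuity in the boundary height\<close>

lemma tendsto_asc [tendsto_intros]:
  assumes "(a \<longlongrightarrow> a') F" "(b \<longlongrightarrow> b') F" "(u \<longlongrightarrow> u') F" "(v \<longlongrightarrow> v') F"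
  shows "((\<lambda>x. asc r (a x) (b x) (u x) (v x) n) \<longlongrightarrow> asc r a' b' u' v' n) F"
proof (induction n rule: induct_nat_012)
  case (ge2 n)
  show ?case unfolding asc.simps divide_inverse
    by (intro tendsto_intros assms ge2)
qed (use assms in \<open>auto simp: divide_inverse intro!: tendsto_intros\<close>)

lemma tendsto_q_num [tendsto_intros]:
  assumes "q > 0" "(f \<longlongrightarrow> a) F"
  shows "((\<lambda>x. q_num q (f x)) \<longlongrightarrow> q_num q a) F"
  unfolding q_num_def divide_inverse using assms by (auto intro!: tendsto_intros)

text \<open>Through \<open>asc\<close>, \<open>p_A\<close> is a finite expression in powers of q, so
  no limit is interchanged with the infinite series.\<close>

lemma tendsto_p_A:
  assumes q: "q > 0" "q \<noteq> 1" and k: "k > 0" and h: "(h \<longlongrightarrow> h') F"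
  shows "((\<lambda>y. p_A q n x (h y) k) \<longlongrightarrow> p_A q n x h' k) F"
  unfolding p_A_eq_asc[OF q k] using q h by (intro tendsto_intros) auto

lemma tendsto_two_site:
  assumes "q > 0" "q \<noteq> 1" "k1 > 0" "k2 > 0"
  shows "((\<lambda>\<rho>. two_site q k1 k2 \<rho> n1 n2 x1 x2) \<longlongrightarrow> two_site q k1 k2 \<rho>' n1 n2 x1 x2) (at \<rho>')"
  unfolding two_site_def using assms by (intro tendsto_intros tendsto_p_A) auto

text \<open>The conventions for empty sites remove the denominators they concern, so a vanishing
  denominator has to be excluded only where the sites in question are occupied.\<close>

lemma tendsto_two_site_dyn_right:
  assumes q: "q > 0" "q \<noteq> 1"
    and "x1 > 0 \<Longrightarrow> \<rho>' + 2 * real x2 + k2 \<noteq> - 1" "x1 > 0 \<Longrightarrow> x2 > 0 \<Longrightarrow> \<rho>' + 2 * real x2 + k2 \<noteq> 0"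
  shows "((\<lambda>\<rho>. two_site_dyn_right q k1 k2 \<rho> x1 x2) \<longlongrightarrow> two_site_dyn_right q k1 k2 \<rho>' x1 x2) (at \<rho>')"
proof (cases "x1 = 0")
  case False
  then have 1: "q_num q (\<rho>' + (2 * real x2 + k2) + 1) \<noteq> 0"
    using assms(3) by (simp add: q_num_eq_0_iff[OF q])
  show ?thesis
  proof (cases "x2 = 0")
    case True
    with False 1 q show ?thesis
      unfolding two_site_dyn_right_def Let_def by (auto intro!: tendsto_intros)
  next
    case x2: False
    then have "q_num q (\<rho>' + (2 * real x2 + k2)) \<noteq> 0"
      using assms(4) False by (simp add: q_num_eq_0_iff[OF q])
    with False x2 1 q show ?thesis
      unfolding two_site_dyn_right_def Let_def by (auto intro!: tendsto_intros)
  qed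
qed (simp add: two_site_dyn_right_def)

lemma tendsto_two_site_dyn_left:
  assumes q: "q > 0" "q \<noteq> 1"
    and "x2 > 0 \<Longrightarrow> \<rho>' + 2 * real x2 + k2 \<noteq> 0" "x2 > 0 \<Longrightarrow> \<rho>' + 2 * real x2 + k2 \<noteq> 1"
  shows "((\<lambda>\<rho>. two_site_dyn_left q k1 k2 \<rho> x1 x2) \<longlongrightarrow> two_site_dyn_left q k1 k2 \<rho>' x1 x2) (at \<rho>')"
proof (cases "x2 = 0")
  case False
  then have "q_num q (\<rho>' + (2 * real x2 + k2)) \<noteq> 0" "q_num q (\<rho>' + (2 * real x2 + k2) - 1) \<noteq> 0"
    using assms(3,4) by (simp_all add: q_num_eq_0_iff[OF q])
  with False q show ?thesis
    unfolding two_site_dyn_left_def Let_def by (auto intro!: tendsto_intros)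
qed (simp add: two_site_dyn_left_def)

text \<open>
  The partial fractions degenerate where the height is \<open>0\<close> or \<open>\<plusminus> 1\<close>; these cases follow by
  continuity in \<open>\<rho>\<close>.
\<close>

lemma two_site_duality:
  fixes q k1 k2 \<rho> :: real
  assumes q: "q > 0" "q \<noteq> 1" and k: "k1 > 0" "k2 > 0"
    and h: "x1 > 0 \<Longrightarrow> \<rho> + 2 * real x2 + k2 \<noteq> - 1" "x1 > 0 \<Longrightarrow> x2 > 0 \<Longrightarrow> \<rho> + 2 * real x2 + k2 \<noteq> 0"
      "x2 > 0 \<Longrightarrow> \<rho> + 2 * real x2 + k2 \<noteq> 0" "x2 > 0 \<Longrightarrow> \<rho> + 2 * real x2 + k2 \<noteq> 1"
  defines "D \<equiv> two_site q k1 k2"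
  shows "two_site_right q k1 k2 n1 n2 * (D \<rho> (n1 - 1) (Suc n2) x1 x2 - D \<rho> n1 n2 x1 x2)
       + two_site_left q k1 k2 n1 n2 * (D \<rho> (Suc n1) (n2 - 1) x1 x2 - D \<rho> n1 n2 x1 x2)
       = two_site_dyn_right q k1 k2 \<rho> x1 x2 * (D \<rho> n1 n2 (x1 - 1) (Suc x2) - D \<rho> n1 n2 x1 x2)
       + two_site_dyn_left q k1 k2 \<rho> x1 x2 * (D \<rho> n1 n2 (Suc x1) (x2 - 1) - D \<rho> n1 n2 x1 x2)"
    (is "?lhs \<rho> = ?rhs \<rho>")
\<comment> \<open>Off three values of the boundary height the generic case applies, so the right
  side tends both to its own value at \<rho> and to that of the left side.\<close>
proof (rule tendsto_unique)
  show "at \<rho> \<noteq> bot" by simp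
  show "(?rhs \<longlongrightarrow> ?rhs \<rho>) (at \<rho>)"
    unfolding D_def
    by (intro tendsto_intros tendsto_two_site tendsto_two_site_dyn_right tendsto_two_site_dyn_left assms) auto
  have lim: "(?lhs \<longlongrightarrow> ?lhs \<rho>) (at \<rho>)"
    unfolding D_def by (intro tendsto_intros tendsto_two_site q k)
  have "\<forall>\<^sub>F \<rho>' in at \<rho>. \<rho>' \<noteq> - (2 * real x2 + k2) \<and> \<rho>' \<noteq> 1 - (2 * real x2 + k2) \<and> \<rho>' \<noteq> - 1 - (2 * real x2 + k2)"
    by (intro eventually_conj eventually_neq_at_within)
  then have "\<forall>\<^sub>F \<rho>' in at \<rho>. ?lhs \<rho>' = ?rhs \<rho>'"
  proof eventually_elim
    case (elim \<rho>')
    then show ?case unfolding D_def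
      by (intro two_site_duality_generic q k) linarith+
  qed
  with lim show "(?rhs \<longlongrightarrow> ?lhs \<rho>) (at \<rho>)"
    by (rule Lim_transform_eventually)
qed

subsection \<open>Reduction to two sites\<close>

text \<open>Conservation of the particle number on the bond is included because it keeps the outer
  heights and the nonlocal part of \<open>u_weight\<close> fixed.\<close>

definition agree_off_bond :: "nat \<Rightarrow> config \<Rightarrow> config \<Rightarrow> bool" where
  "agree_off_bond j \<eta> \<eta>' \<longleftrightarrow>
     (\<forall>i. i \<noteq> j \<and> i \<noteq> Suc j \<longrightarrow> \<eta>' i = \<eta> i) \<and> \<eta>' j + \<eta>' (Suc j) = \<eta> j + \<eta> (Suc j)"

lemma agree_off_bond_refl: "agree_off_bond j \<eta> \<eta>"
  by (simp add: agree_off_bond_def)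

lemma agree_off_bond_move:
  "agree_off_bond j \<eta> (move \<eta> j (Suc j))" "agree_off_bond j \<eta> (move \<eta> (Suc j) j)"
  by (auto simp: agree_off_bond_def move_def)

lemma move_apply:
  assumes "\<eta> j > 0" "j \<noteq> m"
  shows "move \<eta> j m j = \<eta> j - 1" "move \<eta> j m m = Suc (\<eta> m)"
  using assms by (simp_all add: move_def)

lemma sum_bond:
  fixes f :: "nat \<Rightarrow> real"
  assumes "finite A" "j \<in> A" "Suc j \<in> A"
  shows "sum f A = f j + f (Suc j) + sum f (A - {j, Suc j})"
proof -
  have "A = insert j (insert (Suc j) (A - {j, Suc j}))" using assms by auto
  then have "sum f A = sum f (insert j (insert (Suc j) (A - {j, Suc j})))" by simp
  also have "\<dots> = f j + f (Suc j) + sum f (A - {j, Suc j})" using assms by simp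
  finally show ?thesis .
qed

lemma prod_bond:
  fixes f :: "nat \<Rightarrow> real"
  assumes "finite A" "j \<in> A" "Suc j \<in> A"
  shows "prod f A = f j * f (Suc j) * prod f (A - {j, Suc j})"
proof -
  have "A = insert j (insert (Suc j) (A - {j, Suc j}))" using assms by auto
  then have "prod f A = prod f (insert j (insert (Suc j) (A - {j, Suc j})))" by simp
  also have "\<dots> = f j * f (Suc j) * prod f (A - {j, Suc j})" using assms by simp
  finally show ?thesis .
qed

text \<open>A height sum contains both sites of the bond or neither, unless it starts at the right
  one.\<close>

lemma height_agree_off_bond:
  assumes "agree_off_bond j \<xi> \<xi>'" "i \<noteq> Suc j" "j < M"
  shows "height M k \<rho> i \<xi>' = height M k \<rho> i \<xi>"
proof (cases "i \<le> j")
  case True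
  then have j: "j \<in> {i..M}" "Suc j \<in> {i..M}" using assms by auto
  have "(\<Sum>i\<in>{i..M} - {j, Suc j}. 2 * real (\<xi>' i) + k i) = (\<Sum>i\<in>{i..M} - {j, Suc j}. 2 * real (\<xi> i) + k i)"
    using assms(1) by (intro sum.cong) (auto simp: agree_off_bond_def)
  moreover have "real (\<xi>' j) + real (\<xi>' (Suc j)) = real (\<xi> j) + real (\<xi> (Suc j))"
    using assms(1) unfolding agree_off_bond_def by linarith
  ultimately show ?thesis unfolding height_def sum_bond[OF finite_atLeastAtMost j] by simp
next
  case False
  then show ?thesis using assms(1,2) unfolding height_def agree_off_bond_def
    by (intro arg_cong2[of _ _ _ _ "(+)"] sum.cong) auto
qed

text \<open>The term with \<eta>_j + \<eta>_(j+1) is the share of the bond in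
  \<open>u_weight\<close> that jumps across it preserve; the rest of that share belongs to
  \<open>two_site\<close>.\<close>

definition off_bond :: "real \<Rightarrow> nat \<Rightarrow> (nat \<Rightarrow> real) \<Rightarrow> real \<Rightarrow> nat \<Rightarrow> config \<Rightarrow> config \<Rightarrow> real" where
  "off_bond q M k \<rho> j \<eta> \<xi> =
     q powr (- (1 / 2) * ((\<Sum>i\<in>{1..M} - {j, Suc j}. real (\<eta> i) * (k i + 2 * (\<Sum>l\<in>{1..<i}. k l))) +
                          2 * (\<Sum>l\<in>{1..<j}. k l) * real (\<eta> j + \<eta> (Suc j)))) *
     (\<Prod>i\<in>{1..M} - {j, Suc j}. p_A q (\<eta> i) (\<xi> i) (height M k \<rho> (i + 1) \<xi>) (k i))"

lemma off_bond_agree: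
  assumes "agree_off_bond j \<eta> \<eta>'" "agree_off_bond j \<xi> \<xi>'" "j < M"
  shows "off_bond q M k \<rho> j \<eta>' \<xi>' = off_bond q M k \<rho> j \<eta> \<xi>"
proof -
  have "(\<Sum>i\<in>{1..M} - {j, Suc j}. real (\<eta>' i) * (k i + 2 * (\<Sum>l\<in>{1..<i}. k l))) =
        (\<Sum>i\<in>{1..M} - {j, Suc j}. real (\<eta> i) * (k i + 2 * (\<Sum>l\<in>{1..<i}. k l)))"
    using assms(1) by (intro sum.cong) (auto simp: agree_off_bond_def)
  moreover have "(\<Prod>i\<in>{1..M} - {j, Suc j}. p_A q (\<eta>' i) (\<xi>' i) (height M k \<rho> (i + 1) \<xi>') (k i)) =
      (\<Prod>i\<in>{1..M} - {j, Suc j}. p_A q (\<eta> i) (\<xi> i) (height M k \<rho> (i + 1) \<xi>) (k i))"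
    using assms by (intro prod.cong) (auto simp: agree_off_bond_def height_agree_off_bond)
  moreover have "\<eta>' j + \<eta>' (Suc j) = \<eta> j + \<eta> (Suc j)"
    using assms(1) by (simp add: agree_off_bond_def)
  ultimately show ?thesis unfolding off_bond_def by simp
qed

lemma height_rec: "j \<le> M \<Longrightarrow> height M k \<rho> j \<xi> = height M k \<rho> (Suc j) \<xi> + (2 * real (\<xi> j) + k j)"
  by (simp add: height_def sum.atLeast_Suc_atMost)

lemma P_R_eq_two_site:
  assumes "1 \<le> j" "j < M"
  shows "P_R q M k \<rho> \<eta> \<xi> = off_bond q M k \<rho> j \<eta> \<xi> *
    two_site q (k j) (k (Suc j)) (height M k \<rho> (Suc (Suc j)) \<xi>) (\<eta> j) (\<eta> (Suc j)) (\<xi> j) (\<xi> (Suc j))"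
proof -
  have j: "j \<in> {1..M}" "Suc j \<in> {1..M}" using assms by auto
  have K: "(\<Sum>l\<in>{1..<Suc j}. k l) = (\<Sum>l\<in>{1..<j}. k l) + k j"
    using assms by simp
  have "u_weight M k \<eta> = ((\<Sum>i\<in>{1..M} - {j, Suc j}. real (\<eta> i) * (k i + 2 * (\<Sum>l\<in>{1..<i}. k l))) +
                          2 * (\<Sum>l\<in>{1..<j}. k l) * real (\<eta> j + \<eta> (Suc j)))
        + (real (\<eta> j) * k j + real (\<eta> (Suc j)) * (k (Suc j) + 2 * k j))"
    unfolding u_weight_def sum_bond[OF finite_atLeastAtMost j] K by (simp add: algebra_simps)
  then have "q powr (- (1 / 2) * u_weight M k \<eta>) =
      q powr (- (1 / 2) * ((\<Sum>i\<in>{1..M} - {j, Suc j}. real (\<eta> i) * (k i + 2 * (\<Sum>l\<in>{1..<i}. k l))) +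
                          2 * (\<Sum>l\<in>{1..<j}. k l) * real (\<eta> j + \<eta> (Suc j)))) *
      q powr (- (1 / 2) * (real (\<eta> j) * k j + real (\<eta> (Suc j)) * (k (Suc j) + 2 * k j)))"
    by (simp only: distrib_left powr_add)
  moreover have "height M k \<rho> (j + 1) \<xi> = height M k \<rho> (Suc (Suc j)) \<xi> + (2 * real (\<xi> (Suc j)) + k (Suc j))"
    using height_rec[of "Suc j" M k \<rho> \<xi>] assms by simp
  ultimately show ?thesis
    unfolding P_R_def off_bond_def two_site_def prod_bond[OF finite_atLeastAtMost j]
    by simp
qed

section \<open>Duality on one bond of the chain\<close>

lemma bond_duality:
  fixes q \<rho> :: real
  assumes q: "q > 0" "q \<noteq> 1" and k: "\<And>j. j \<in> {1..M} \<Longrightarrow> k j > 0"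
    and \<xi>: "\<xi> \<in> dyn_configs M k \<rho>" and j: "1 \<le> j" "j < M"
  defines "P \<equiv> P_R q M k \<rho>"
  shows "asip_rate_right q k j \<eta> * (P (move \<eta> j (j + 1)) \<xi> - P \<eta> \<xi>)
       + asip_rate_left q k (j + 1) \<eta> * (P (move \<eta> (j + 1) j) \<xi> - P \<eta> \<xi>)
       = dyn_rate_right q M k \<rho> j \<xi> * (P \<eta> (move \<xi> j (j + 1)) - P \<eta> \<xi>)
       + dyn_rate_left q M k \<rho> (j + 1) \<xi> * (P \<eta> (move \<xi> (j + 1) j) - P \<eta> \<xi>)"
proof -
  define h where "h = height M k \<rho> (Suc (Suc j)) \<xi>"
  define D where "D = two_site q (k j) (k (Suc j)) h"
  define K where "K = off_bond q M k \<rho> j \<eta> \<xi>"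
  define D0 where "D0 = D (\<eta> j) (\<eta> (Suc j)) (\<xi> j) (\<xi> (Suc j))"
  have h1: "height M k \<rho> (Suc j) \<xi> = h + (2 * real (\<xi> (Suc j)) + k (Suc j))"
    unfolding h_def using j by (intro height_rec) auto
  have h0: "height M k \<rho> j \<xi> = height M k \<rho> (Suc j) \<xi> + (2 * real (\<xi> j) + k j)"
    using j by (intro height_rec) auto
  have kj: "k j > 0" "k (Suc j) > 0" using k j by auto
  have P: "P \<eta>' \<xi>' = K * D (\<eta>' j) (\<eta>' (Suc j)) (\<xi>' j) (\<xi>' (Suc j))"
    if "agree_off_bond j \<eta> \<eta>'" "agree_off_bond j \<xi> \<xi>'" for \<eta>' \<xi>'
    unfolding P_def K_def D_def h_def P_R_eq_two_site[OF j]
    using off_bond_agree[OF that j(2)] height_agree_off_bond[OF that(2) _ j(2), of "Suc (Suc j)"] by simp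
  have P0: "P \<eta> \<xi> = K * D0"
    unfolding D0_def by (intro P agree_off_bond_refl)
  have factor: "x * (K * y - P \<eta> \<xi>) = K * (x * (y - D0))" for x y
    unfolding P0 by (simp add: algebra_simps)
  have a1: "asip_rate_right q k j \<eta> = two_site_right q (k j) (k (Suc j)) (\<eta> j) (\<eta> (Suc j))"
    and a2: "asip_rate_left q k (j + 1) \<eta> = two_site_left q (k j) (k (Suc j)) (\<eta> j) (\<eta> (Suc j))"
    by (simp_all add: asip_rate_right_def asip_rate_left_def two_site_right_def two_site_left_def)
  have r1: "dyn_rate_right q M k \<rho> j \<xi> = two_site_dyn_right q (k j) (k (Suc j)) h (\<xi> j) (\<xi> (Suc j))"
    unfolding dyn_rate_right_def two_site_dyn_right_def Let_def by (simp add: h0 h1)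
  have r2: "dyn_rate_left q M k \<rho> (j + 1) \<xi> = two_site_dyn_left q (k j) (k (Suc j)) h (\<xi> j) (\<xi> (Suc j))"
    unfolding dyn_rate_left_def two_site_dyn_left_def Let_def by (simp add: h1 h_def[symmetric])
  \<comment> \<open>For an empty site \<open>move\<close> is the identity, whereas the two-site form
    contains a truncated subtraction; the rate is 0, so both terms vanish. The same applies to
    \<open>c2\<close>, \<open>C1\<close> and \<open>C2\<close>.\<close>
  have c1: "asip_rate_right q k j \<eta> * (P (move \<eta> j (j + 1)) \<xi> - P \<eta> \<xi>) =
      K * (two_site_right q (k j) (k (Suc j)) (\<eta> j) (\<eta> (Suc j)) * (D (\<eta> j - 1) (Suc (\<eta> (Suc j))) (\<xi> j) (\<xi> (Suc j)) - D0))"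
  proof (cases "\<eta> j > 0")
    case True
    then show ?thesis
      using P[OF agree_off_bond_move(1) agree_off_bond_refl] unfolding a1 by (simp add: move_apply factor)
  qed (simp add: a1 two_site_right_def)
  have c2: "asip_rate_left q k (j + 1) \<eta> * (P (move \<eta> (j + 1) j) \<xi> - P \<eta> \<xi>) =
      K * (two_site_left q (k j) (k (Suc j)) (\<eta> j) (\<eta> (Suc j)) * (D (Suc (\<eta> j)) (\<eta> (Suc j) - 1) (\<xi> j) (\<xi> (Suc j)) - D0))"
  proof (cases "\<eta> (Suc j) > 0")
    case True
    then show ?thesis
      using P[OF agree_off_bond_move(2) agree_off_bond_refl] unfolding a2 by (simp add: move_apply factor)
  qed (simp add: a2[simplified] two_site_left_def)
  have C1: "dyn_rate_right q M k \<rho> j \<xi> * (P \<eta> (move \<xi> j (j + 1)) - P \<eta> \<xi>) =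
      K * (two_site_dyn_right q (k j) (k (Suc j)) h (\<xi> j) (\<xi> (Suc j)) * (D (\<eta> j) (\<eta> (Suc j)) (\<xi> j - 1) (Suc (\<xi> (Suc j))) - D0))"
  proof (cases "\<xi> j > 0")
    case True
    then show ?thesis
      using P[OF agree_off_bond_refl agree_off_bond_move(1)] unfolding r1 by (simp add: move_apply factor)
  qed (simp add: r1 two_site_dyn_right_def)
  have C2: "dyn_rate_left q M k \<rho> (j + 1) \<xi> * (P \<eta> (move \<xi> (j + 1) j) - P \<eta> \<xi>) =
      K * (two_site_dyn_left q (k j) (k (Suc j)) h (\<xi> j) (\<xi> (Suc j)) * (D (\<eta> j) (\<eta> (Suc j)) (Suc (\<xi> j)) (\<xi> (Suc j) - 1) - D0))"
  proof (cases "\<xi> (Suc j) > 0")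
    case True
    then show ?thesis
      using P[OF agree_off_bond_refl agree_off_bond_move(2)] unfolding r2 by (simp add: move_apply factor)
  qed (simp add: r2[simplified] two_site_dyn_left_def)

  \<comment> \<open>Here the state space enters. Heights grow from right to left: for \<rho> > -1
    they start above -1, and otherwise they are bounded by the height at site 1, which is
    negative.\<close>
  have dichotomy: "h > - 1 \<or> h + (2 * real (\<xi> (Suc j)) + k (Suc j)) + (2 * real (\<xi> j) + k j) < 0"
  proof (cases "\<rho> > - 1")
    case True
    have "(\<Sum>i=Suc (Suc j)..M. 2 * real (\<xi> i) + k i) \<ge> 0"
      using k by (intro sum_nonneg add_nonneg_nonneg less_imp_le[of 0 "k _"]) auto
    then show ?thesis using True by (simp add: h_def height_def)
  next
    case False
    have "height M k \<rho> 1 \<xi> < 0"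
      using \<xi> False by (simp add: dyn_configs_def height_def sum.distrib sum_distrib_left add_ac)
    moreover have "(\<Sum>i=j..M. 2 * real (\<xi> i) + k i) \<le> (\<Sum>i=1..M. 2 * real (\<xi> i) + k i)"
      using k j by (intro sum_mono2 add_nonneg_nonneg less_imp_le[of 0 "k _"]) auto
    ultimately have "height M k \<rho> j \<xi> < 0" by (simp add: height_def)
    then show ?thesis by (simp add: h0 h1)
  qed
  have pos: "x > 0 \<Longrightarrow> real x \<ge> 1" for x by simp
  have "two_site_right q (k j) (k (Suc j)) (\<eta> j) (\<eta> (Suc j)) * (D (\<eta> j - 1) (Suc (\<eta> (Suc j))) (\<xi> j) (\<xi> (Suc j)) - D0)
     + two_site_left q (k j) (k (Suc j)) (\<eta> j) (\<eta> (Suc j)) * (D (Suc (\<eta> j)) (\<eta> (Suc j) - 1) (\<xi> j) (\<xi> (Suc j)) - D0)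
     = two_site_dyn_right q (k j) (k (Suc j)) h (\<xi> j) (\<xi> (Suc j)) * (D (\<eta> j) (\<eta> (Suc j)) (\<xi> j - 1) (Suc (\<xi> (Suc j))) - D0)
     + two_site_dyn_left q (k j) (k (Suc j)) h (\<xi> j) (\<xi> (Suc j)) * (D (\<eta> j) (\<eta> (Suc j)) (Suc (\<xi> j)) (\<xi> (Suc j) - 1) - D0)"
    unfolding D0_def D_def
    \<comment> \<open>In the first case the middle height exceeds -1, and exceeds 1 if the right
      site is occupied; in the second it is negative, and below -1 if the left site is occupied.
      This excludes every zero denominator in a jump from an occupied site.\<close>
    by (rule two_site_duality[OF q kj]; use dichotomy kj pos[of "\<xi> j"] pos[of "\<xi> (Suc j)"] in linarith)
  then show ?thesis unfolding c1 c2 C1 C2 by (simp only: distrib_left[symmetric])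
qed

theorem theorem2p6:
  fixes q \<rho> :: real and M :: nat and k :: "nat \<Rightarrow> real"
  assumes "q > 0" and "q \<noteq> 1"
    and "M \<ge> 1"
    and "\<And>j. j \<in> {1..M} \<Longrightarrow> k j > 0"
  shows "duality_function (configs M) (asip_generator q M k)
           (dyn_configs M k \<rho>) (dyn_asip_generator q M k \<rho>) (P_R q M k \<rho>)"
  unfolding duality_function_def asip_generator_def dyn_asip_generator_def jump_generator_def
  by (intro ballI sum.cong refl bond_duality assms) auto

end
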